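(* For a fixed finite alphabet $\Sigma$, there is an algorithm that, given an $m\times n$ array $A$ over $\Sigma$, decides whether $A$ is primitive and computes the primitive root of $A$ (together with its dimensions) in $O(mn)$ time.
   Context: For an $m\times n$ array $A$ (indexed from $0$) and positive integers $p,q$, $A^{p\times q}$ is the $pm \times qn$ array $B$ with $B[i,j] = A[i \bmod m, j \bmod n]$. A nonempty array $M$ is primitive if $M = B^{p\times q}$ with $p,q$ positive integers implies $p=q=1$. Every nonempty array $A$ can be written as $A = C^{i\times j}$ for a unique primitive array $C$ and positive integers $i,j$; this $C$ is the primitive root of $A$. Running time is measured in the standard RAM model. *)

theory Defs
  imports Complex_Main "Jordan_Normal_Form.Matrix"
begin

section \<open>Primitive arrays\<close>

definition array_power :: "'a mat \<Rightarrow> nat \<Rightarrow> nat \<Rightarrow> 'a mat" where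
  "array_power A p q =
     mat (p * dim_row A) (q * dim_col A) (\<lambda>(i, j). A $$ (i mod dim_row A, j mod dim_col A))"

definition nonempty_array :: "'a mat \<Rightarrow> bool" where
  "nonempty_array A \<longleftrightarrow> dim_row A > 0 \<and> dim_col A > 0"

definition primitive_array :: "'a mat \<Rightarrow> bool" where
  "primitive_array M \<longleftrightarrow> nonempty_array M \<and>
     (\<forall>B p q. p > 0 \<longrightarrow> q > 0 \<longrightarrow> M = array_power B p q \<longrightarrow> p = 1 \<and> q = 1)"

definition primitive_root :: "'a mat \<Rightarrow> 'a mat" where
  "primitive_root A =
     (THE C. primitive_array C \<and> (\<exists>i j. i > 0 \<and> j > 0 \<and> A = array_power C i j))"

lemma dim_array_power [simp]:
  "dim_row (array_power A p q) = p * dim_row A"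
  "dim_col (array_power A p q) = q * dim_col A"
  by (simp_all add: array_power_def)

lemma index_array_power [simp]:
  "i < p * dim_row A \<Longrightarrow> j < q * dim_col A \<Longrightarrow>
     array_power A p q $$ (i, j) = A $$ (i mod dim_row A, j mod dim_col A)"
  by (simp add: array_power_def)

lemma array_power_array_power:
  "array_power (array_power C i j) p q = array_power C (p * i) (q * j)"
proof (rule eq_matI, goal_cases)
  case (1 a b)
  have "0 < i * dim_row C" "0 < j * dim_col C" using 1 by (auto intro: Nat.gr0I)
  hence "a mod (i * dim_row C) < i * dim_row C" "b mod (j * dim_col C) < j * dim_col C"
    by simp_all
  thus ?case using 1 by (simp add: mult.assoc mod_mod_cancel)
qed (simp_all add: mult.assoc)

lemma array_power_1_1: "array_power A (Suc 0) (Suc 0) = A"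
  by (rule eq_matI) auto

lemma transpose_array_power:
  "transpose_mat (array_power C i j) = array_power (transpose_mat C) j i"
proof (rule eq_matI, goal_cases)
  case (1 a b)
  have "0 < dim_row C" "0 < dim_col C" using 1 by (auto intro: Nat.gr0I)
  thus ?case using 1 by simp
qed simp_all

lemma primitive_array_transpose:
  assumes "primitive_array C"
  shows "primitive_array (transpose_mat C)"
  unfolding primitive_array_def
proof (intro conjI allI impI)
  show "nonempty_array (transpose_mat C)"
    using assms by (simp add: primitive_array_def nonempty_array_def)
  fix B p q assume pq: "0 < (p::nat)" "0 < (q::nat)" "transpose_mat C = array_power B p q"
  hence "C = array_power (transpose_mat B) q p"
    by (metis transpose_array_power Matrix.transpose_transpose)
  with assms pq show "p = 1" "q = 1" unfolding primitive_array_def by metis+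
qed

lemma primitive_root_exists:
  assumes "nonempty_array A"
  shows "\<exists>C i j. primitive_array C \<and> i > 0 \<and> j > 0 \<and> A = array_power C i j"
  using assms
proof (induction "dim_row A * dim_col A" arbitrary: A rule: less_induct)
  case less
  show ?case
  proof (cases "primitive_array A")
    case True
    thus ?thesis using array_power_1_1[of A] by (metis zero_less_Suc)
  next
    case False
    then obtain B p q where B: "p > 0" "q > 0" "A = array_power B p q" "p \<noteq> 1 \<or> q \<noteq> 1"
      using less.prems unfolding primitive_array_def by blast
    have ne: "dim_row B > 0" "dim_col B > 0"
      using less.prems B by (simp_all add: nonempty_array_def)
    have "p * q > 1" using B by (metis One_nat_def Suc_lessI mult_eq_1_iff nat_0_less_mult_iff)
    hence "1 * (dim_row B * dim_col B) < (p * q) * (dim_row B * dim_col B)"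
      using ne by (intro mult_strict_right_mono) auto
    hence "dim_row B * dim_col B < dim_row A * dim_col A"
      using B by (simp add: ac_simps)
    then obtain C i j where "primitive_array C" "i > 0" "j > 0" "B = array_power C i j"
      using less.hyps[of B] ne by (auto simp: nonempty_array_def)
    thus ?thesis using B array_power_array_power[of C i j p q]
      by (metis nat_0_less_mult_iff)
  qed
qed

lemma primitive_dim_row_dvd:
  assumes C: "primitive_array C" and ij: "i > 0" "j > 0"
    and D: "nonempty_array D" and kl: "k > 0" "l > 0"
    and eq: "array_power C i j = array_power D k l"
  shows "dim_row C dvd dim_row D"
proof -
  define r s g where "r = dim_row C" and "s = dim_row D" and "g = gcd r s"
  have pos: "r > 0" "s > 0" "g > 0" "dim_col C > 0"
    using C D by (auto simp: r_def s_def g_def primitive_array_def nonempty_array_def)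
  have m: "i * r = k * s"
    using arg_cong[OF eq, of dim_row] by (simp add: r_def s_def)
  have n: "j * dim_col C = l * dim_col D"
    using arg_cong[OF eq, of dim_col] by simp
  define f where "f a b = array_power C i j $$ (a mod (i * r), b)" for a b
  have fC: "f a b = C $$ (a mod r, b mod dim_col C)" if "b < j * dim_col C" for a b
    unfolding f_def using that pos ij by (simp add: r_def mod_mod_cancel)
  have fD: "f a b = D $$ (a mod s, b mod dim_col D)" if "b < j * dim_col C" for a b
    unfolding f_def eq m using that pos kl n by (simp add: s_def mod_mod_cancel)
  obtain x y where xy: "r * x = s * y + g"
    using bezout_nat[of r s] pos unfolding g_def by auto
  have fg: "f (a + g) b = f a b" if b: "b < j * dim_col C" for a b
  proof -
    have "f (a + g) b = f (a + g + s * y) b" using b by (simp add: fD)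
    also have "a + g + s * y = a + r * x" using xy by simp
    also have "f \<dots> b = f a b" using b by (simp add: fC)
    finally show ?thesis .
  qed
  have fgt: "f (a + t * g) b = f a b" if b: "b < j * dim_col C" for a b t
  proof (induction t)
    case (Suc t)
    have "f (a + Suc t * g) b = f (a + t * g + g) b" by (simp add: ac_simps)
    thus ?case using Suc fg[OF b] by simp
  qed simp
  have fmod: "f a b = f (a mod g) b" if b: "b < j * dim_col C" for a b
    using fgt[OF b, of "a mod g" "a div g"] by (simp add: mod_div_mult_eq)
  define B where "B = mat g (dim_col C) (\<lambda>(a, b). C $$ (a, b))"
  have gr: "g dvd r" "g \<le> r" using pos by (auto simp: g_def intro: dvd_imp_le)
  have "C = array_power B (r div g) 1"
  proof (rule eq_matI, goal_cases)
    case (1 a b)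
    have ab: "a < r" "b < dim_col C" using 1 gr by (simp_all add: B_def)
    have bj: "b < j * dim_col C"
      using ab ij by (metis Suc_leI less_le_trans mult_1 mult_le_mono1 One_nat_def)
    have ag: "a mod g < g" "a mod g < r" using pos gr mod_less_divisor[of g a] by linarith+
    have "C $$ (a, b) = C $$ (a mod g, b)"
      using fmod[OF bj, of a] ab ag by (simp add: fC[OF bj])
    thus ?case using ab ag gr 1 by (simp add: B_def)
  qed (use gr in \<open>simp_all add: B_def r_def\<close>)
  moreover have "r div g > 0" using pos gr by (simp add: div_greater_zero_iff)
  moreover have "p = 1" if "p > 0" "C = array_power B p 1" for p
    using C that unfolding primitive_array_def by (metis less_numeral_extra(1))
  ultimately have "r div g = 1" by blast
  hence "r = g" using gr by (metis dvd_div_mult_self mult_1)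
  thus ?thesis unfolding g_def r_def s_def by (metis gcd_dvd2)
qed

lemma primitive_dim_col_dvd:
  assumes C: "primitive_array C" and ij: "i > 0" "j > 0"
    and D: "nonempty_array D" and kl: "k > 0" "l > 0"
    and eq: "array_power C i j = array_power D k l"
  shows "dim_col C dvd dim_col D"
proof -
  have "array_power (transpose_mat C) j i = array_power (transpose_mat D) l k"
    using eq by (metis transpose_array_power)
  moreover have "nonempty_array (transpose_mat D)" using D by (simp add: nonempty_array_def)
  ultimately show ?thesis
    using primitive_dim_row_dvd[OF primitive_array_transpose[OF C] ij(2,1) _ kl(2,1),
        of "transpose_mat D"] by simp
qed

lemma primitive_root_unique:
  assumes C: "primitive_array C" "i > 0" "j > 0"
    and D: "primitive_array D" "k > 0" "l > 0"
    and eq: "array_power C i j = array_power D k l"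
  shows "C = D"
proof -
  have ne: "nonempty_array C" "nonempty_array D" using C D by (simp_all add: primitive_array_def)
  have r: "dim_row C = dim_row D" and c: "dim_col C = dim_col D"
    using primitive_dim_row_dvd[OF C ne(2) D(2,3) eq] primitive_dim_row_dvd[OF D ne(1) C(2,3) eq[symmetric]]
      primitive_dim_col_dvd[OF C ne(2) D(2,3) eq] primitive_dim_col_dvd[OF D ne(1) C(2,3) eq[symmetric]]
    by (simp_all add: dvd_antisym)
  show ?thesis
  proof (rule eq_matI[OF _ r c])
    fix a b assume ab: "a < dim_row D" "b < dim_col D"
    have le: "x < t * y" if "x < y" "t > 0" for x y t :: nat
      using that by (metis Suc_leI less_le_trans mult_1 mult_le_mono1 One_nat_def)
    show "C $$ (a, b) = D $$ (a, b)"
      using arg_cong[OF eq, of "\<lambda>M. M $$ (a, b)"] ab C D r c by (simp add: le)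
  qed
qed

theorem primitive_root_ex1:
  assumes "nonempty_array A"
  shows "\<exists>!C. primitive_array C \<and> (\<exists>i j. i > 0 \<and> j > 0 \<and> A = array_power C i j)"
  using primitive_root_exists[OF assms] primitive_root_unique by metis


section \<open>Random access machine\<close>

text \<open>
  A unit-cost word RAM: a program is a fixed list of instructions operating on registers and
  on a random-access memory, both holding natural numbers. Register operands are part of the
  instruction, so a program uses finitely many registers. \<open>Sub\<close> is truncated subtraction and
  division by \<open>0\<close> yields \<open>0\<close>.
\<close>

datatype instr =
    Const nat nat       \<comment> \<open>\<open>R\<^sub>a := c\<close>\<close>
  | Add nat nat nat     \<comment> \<open>\<open>R\<^sub>a := R\<^sub>b + R\<^sub>c\<close>; likewise for the next three\<close>
  | Sub nat nat nat
  | Mul nat nat nat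
  | Div nat nat nat
  | Load nat nat        \<comment> \<open>\<open>R\<^sub>a := M[R\<^sub>b]\<close>\<close>
  | Store nat nat       \<comment> \<open>\<open>M[R\<^sub>a] := R\<^sub>b\<close>\<close>
  | Jump nat            \<comment> \<open>continue at instruction \<open>l\<close>\<close>
  | JumpZ nat nat       \<comment> \<open>continue at instruction \<open>l\<close> if \<open>R\<^sub>a = 0\<close>\<close>

record config =
  pc :: nat
  reg :: "nat \<Rightarrow> nat"
  mem :: "nat \<Rightarrow> nat"

definition set_reg :: "nat \<Rightarrow> nat \<Rightarrow> config \<Rightarrow> config" where
  "set_reg a v s = s\<lparr>pc := pc s + 1, reg := (reg s)(a := v)\<rparr>"

fun exec_instr :: "instr \<Rightarrow> config \<Rightarrow> config" where
  "exec_instr (Const a c) s = set_reg a c s"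
| "exec_instr (Add a b c) s = set_reg a (reg s b + reg s c) s"
| "exec_instr (Sub a b c) s = set_reg a (reg s b - reg s c) s"
| "exec_instr (Mul a b c) s = set_reg a (reg s b * reg s c) s"
| "exec_instr (Div a b c) s = set_reg a (reg s b div reg s c) s"
| "exec_instr (Load a b) s = set_reg a (mem s (reg s b)) s"
| "exec_instr (Store a b) s = s\<lparr>pc := pc s + 1, mem := (mem s)(reg s a := reg s b)\<rparr>"
| "exec_instr (Jump l) s = s\<lparr>pc := l\<rparr>"
| "exec_instr (JumpZ a l) s = s\<lparr>pc := (if reg s a = 0 then l else pc s + 1)\<rparr>"

definition fits :: "nat \<Rightarrow> config \<Rightarrow> bool" where
  "fits w s \<longleftrightarrow> (\<forall>a. reg s a < 2 ^ w) \<and> (\<forall>a. mem s a < 2 ^ w)"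

text \<open>
  An instruction whose result does not fit into a \<open>w\<close>-bit word gets the machine stuck without
  halting. Without this restriction unit-cost multiplication would be unrealistically strong.
\<close>

definition ram_step :: "instr list \<Rightarrow> nat \<Rightarrow> config \<Rightarrow> config \<Rightarrow> bool" where
  "ram_step P w s s' \<longleftrightarrow> pc s < length P \<and> s' = exec_instr (P ! pc s) s \<and> fits w s'"

definition halted :: "instr list \<Rightarrow> config \<Rightarrow> bool" where
  "halted P s \<longleftrightarrow> pc s \<ge> length P"

definition ram_run :: "instr list \<Rightarrow> nat \<Rightarrow> nat \<Rightarrow> config \<Rightarrow> config \<Rightarrow> bool" where
  "ram_run P w t s s' \<longleftrightarrow> fits w s \<and> (ram_step P w ^^ t) s s' \<and> halted P s'"

text \<open>
  Input and output conventions. Letters are represented by numbers through \<open>code\<close>, arrays are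
  stored in row-major order from address \<open>0\<close>. Input: the dimensions in registers 0 and 1, the
  array in memory, everything else \<open>0\<close>. Output: the primitivity bit in register 0, the
  dimensions of the root in registers 1 and 2, the root in memory.
\<close>

definition input_config :: "('a \<Rightarrow> nat) \<Rightarrow> 'a mat \<Rightarrow> config" where
  "input_config code A =
     \<lparr> pc = 0,
       reg = (\<lambda>_. 0)(0 := dim_row A, 1 := dim_col A),
       mem = (\<lambda>a. if a < dim_row A * dim_col A
                  then code (A $$ (a div dim_col A, a mod dim_col A)) else 0) \<rparr>"

definition stores_array :: "('a \<Rightarrow> nat) \<Rightarrow> config \<Rightarrow> 'a mat \<Rightarrow> bool" where
  "stores_array code s C \<longleftrightarrow>
     (\<forall>i < dim_row C. \<forall>j < dim_col C. mem s (i * dim_col C + j) = code (C $$ (i, j)))"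

definition output_correct :: "('a \<Rightarrow> nat) \<Rightarrow> 'a mat \<Rightarrow> config \<Rightarrow> bool" where
  "output_correct code A s \<longleftrightarrow>
     reg s 0 = (if primitive_array A then 1 else 0) \<and>
     reg s 1 = dim_row (primitive_root A) \<and>
     reg s 2 = dim_col (primitive_root A) \<and>
     stores_array code s (primitive_root A)"

end

theory Submission
  imports Defs
begin

text \<open>
  Periods in the two directions are independent: if \<open>r\<close> is the least divisor of \<open>m\<close> that is a
  period of the rows and \<open>c\<close> the least divisor of \<open>n\<close> that is a period of the columns, then the
  top left \<open>r \<times> c\<close> corner is the primitive root. Read row by row, the array is a string of length
  \<open>N = m n\<close>, and \<open>d\<close> is a row period iff the string has period \<open>d n\<close>. How far the string keeps
  the period \<open>i\<close> is computed for all \<open>i \<le> N\<close> in linear time, as in the computation of the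
  Z-function: the right end of the rightmost known match never decreases, and every letter
  comparison that succeeds moves it. Columns are treated by reading the array column by column.
  Time is counted in a while language whose costs are exactly the numbers of instructions that its
  compiled code executes.
\<close>


section \<open>Periods of strings\<close>

definition has_period :: "(nat \<Rightarrow> 'b) \<Rightarrow> nat \<Rightarrow> nat \<Rightarrow> bool" where
  "has_period x r d \<longleftrightarrow> (\<forall>t. d + t < r \<longrightarrow> x t = x (d + t))"

lemma has_period_trivial: "r \<le> d \<Longrightarrow> has_period x r d"
  by (simp add: has_period_def)

lemma has_period_mono: "has_period x r d \<Longrightarrow> s \<le> r \<Longrightarrow> has_period x s d"
  by (simp add: has_period_def)

lemma has_period_Suc:
  assumes "d \<le> r"
  shows "has_period x (Suc r) d \<longleftrightarrow> has_period x r d \<and> x r = x (r - d)"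
proof -
  have "d + t < Suc r \<longleftrightarrow> d + t < r \<or> t = r - d" for t using assms by auto
  thus ?thesis using assms unfolding has_period_def by (metis le_add_diff_inverse)
qed

lemma has_period_cong:
  assumes "\<And>k. k < r \<Longrightarrow> x k = y k"
  shows "has_period x r d \<longleftrightarrow> has_period y r d"
  using assms by (auto simp: has_period_def)

lemma has_period_inj_on:
  assumes "inj_on f (x ` {..<r})"
  shows "has_period (\<lambda>k. f (x k)) r d \<longleftrightarrow> has_period x r d"
  using inj_on_eq_iff[OF assms] by (auto simp: has_period_def)

lemma has_period_add_iff:
  assumes "has_period x r l"
  shows "has_period x r (l + d) \<longleftrightarrow> has_period x (r - l) d"
  using assms by (simp add: has_period_def less_diff_conv add_ac)

text \<open>
  The string agrees with its suffix at \<open>i\<close> up to position \<open>reach x n i\<close>, so that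
  \<open>reach x n i - i\<close> is the usual longest common extension (the entry of the Z-array).
\<close>

definition reach :: "(nat \<Rightarrow> 'b) \<Rightarrow> nat \<Rightarrow> nat \<Rightarrow> nat" where
  "reach x n i = (GREATEST r. r \<le> n \<and> has_period x r i)"

lemma reach:
  shows reach_le: "reach x n i \<le> n"
    and has_period_reach: "has_period x (reach x n i) i"
    and le_reach: "r \<le> n \<Longrightarrow> has_period x r i \<Longrightarrow> r \<le> reach x n i"
proof -
  have "0 \<le> n \<and> has_period x 0 i" by (simp add: has_period_trivial)
  hence "reach x n i \<le> n \<and> has_period x (reach x n i) i"
    unfolding reach_def by (rule GreatestI_nat[where b = n]) simp
  thus "reach x n i \<le> n" "has_period x (reach x n i) i" by simp_all
  show "r \<le> n \<Longrightarrow> has_period x r i \<Longrightarrow> r \<le> reach x n i"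
    unfolding reach_def by (rule Greatest_le_nat[where b = n]) auto
qed

lemma reach_eqI:
  assumes "r \<le> n" "has_period x r i" "r < n \<Longrightarrow> \<not> has_period x (Suc r) i"
  shows "reach x n i = r"
proof (rule antisym)
  show "r \<le> reach x n i" using assms(1,2) by (rule le_reach)
  show "reach x n i \<le> r"
    using assms(3) has_period_mono[OF has_period_reach, of "Suc r" x n i] reach_le[of x n i]
    by (meson Suc_leI le_less_trans not_le)
qed

lemma reach_eq_iff: "reach x n i = n \<longleftrightarrow> has_period x n i"
  using has_period_reach le_reach reach_le by (metis antisym order_refl)

lemma reach_add:
  assumes "has_period x r l" "r \<le> n" "reach x n d + l < r"
  shows "reach x n (l + d) = reach x n d + l"
proof (rule reach_eqI)
  note add_iff = has_period_add_iff[OF has_period_mono[OF assms(1)]]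
  show "reach x n d + l \<le> n" using assms(2,3) by simp
  show "has_period x (reach x n d + l) (l + d)"
    using assms(3) has_period_reach by (simp add: add_iff)
  have "\<not> has_period x (Suc (reach x n d)) d"
    using le_reach[of "Suc (reach x n d)" n x d] assms(2,3) by force
  thus "\<not> has_period x (Suc (reach x n d + l)) (l + d)"
    using assms(3) add_iff[of "Suc (reach x n d + l)" d] by (simp add: Suc_diff_le)
qed

lemma has_period_add_reach:
  assumes "has_period x r l" "r \<le> reach x n d + l"
  shows "has_period x r (l + d)"
  using has_period_mono[OF has_period_reach, of "r - l" x n d] assms(2)
  by (simp add: has_period_add_iff[OF assms(1)])


section \<open>Periods and primitive roots of arrays\<close>

definition row_period :: "'a mat \<Rightarrow> nat \<Rightarrow> bool" where
  "row_period A d \<longleftrightarrow> 0 < d \<and> d dvd dim_row A \<and>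
     (\<forall>i j. d + i < dim_row A \<longrightarrow> j < dim_col A \<longrightarrow> A $$ (i, j) = A $$ (d + i, j))"

lemma row_period_dim_row: "0 < dim_row A \<Longrightarrow> row_period A (dim_row A)"
  by (simp add: row_period_def)

lemma row_period_mod:
  assumes "row_period A d" "i < dim_row A" "j < dim_col A"
  shows "A $$ (i, j) = A $$ (i mod d, j)"
  using assms(2)
proof (induction i rule: less_induct)
  case (less i)
  show ?case
  proof (cases "i < d")
    case False
    hence "A $$ (i - d, j) = A $$ (i, j)"
      using assms less.prems unfolding row_period_def by (metis le_add_diff_inverse not_less)
    moreover have "A $$ (i - d, j) = A $$ ((i - d) mod d, j)"
      using less False assms(1) by (auto simp: row_period_def)
    ultimately show ?thesis using False by (simp add: le_mod_geq)
  qed simp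
qed

lemma row_period_array_power:
  "nonempty_array (array_power B p q) \<Longrightarrow> row_period (array_power B p q) (dim_row B)"
  by (auto simp: row_period_def nonempty_array_def)

definition least_row_period :: "'a mat \<Rightarrow> nat" where
  "least_row_period A = (LEAST d. row_period A d)"

abbreviation least_col_period :: "'a mat \<Rightarrow> nat" where
  "least_col_period A \<equiv> least_row_period (transpose_mat A)"

lemma nonempty_array_transpose: "nonempty_array A \<Longrightarrow> nonempty_array (transpose_mat A)"
  by (simp add: nonempty_array_def)

lemma least_row_period:
  assumes "nonempty_array A"
  shows "row_period A (least_row_period A)" "0 < least_row_period A"
    "least_row_period A dvd dim_row A" "least_row_period A \<le> dim_row A"
proof -
  show "row_period A (least_row_period A)" unfolding least_row_period_def
    by (rule LeastI, rule row_period_dim_row) (use assms in \<open>simp add: nonempty_array_def\<close>)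
  thus "0 < least_row_period A" "least_row_period A dvd dim_row A" by (simp_all add: row_period_def)
  thus "least_row_period A \<le> dim_row A" using assms by (simp add: nonempty_array_def dvd_imp_le)
qed

lemmas least_col_period =
  least_row_period[OF nonempty_array_transpose, unfolded index_transpose_mat]

definition corner :: "'a mat \<Rightarrow> 'a mat" where
  "corner A = mat (least_row_period A) (least_col_period A) (\<lambda>(i, j). A $$ (i, j))"

lemma dim_corner [simp]:
  "dim_row (corner A) = least_row_period A" "dim_col (corner A) = least_col_period A"
  by (simp_all add: corner_def)

lemma corner_transpose:
  assumes "nonempty_array A"
  shows "corner (transpose_mat A) = transpose_mat (corner A)"
proof (rule eq_matI)
  fix i j assume "i < dim_row (transpose_mat (corner A))" "j < dim_col (transpose_mat (corner A))"
  thus "corner (transpose_mat A) $$ (i, j) = transpose_mat (corner A) $$ (i, j)"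
    using least_row_period(4)[OF assms] least_col_period(4)[OF assms] by (simp add: corner_def)
qed simp_all

lemma ex_array_power_corner:
  assumes "nonempty_array A"
  shows "\<exists>p q. 0 < p \<and> 0 < q \<and> A = array_power (corner A) p q"
proof -
  define r c where "r = least_row_period A" and "c = least_col_period A"
  note r = least_row_period[OF assms, folded r_def] and c = least_col_period[OF assms, folded c_def]
  obtain p q where p: "dim_row A = p * r" and q: "dim_col A = q * c"
    using r(3) c(3) by (metis dvdE mult.commute)
  have "0 < p" "0 < q" using p q assms by (auto simp: nonempty_array_def intro: Nat.gr0I)
  moreover have "A = array_power (corner A) p q"
  proof (rule eq_matI)
    fix i j
    assume "i < dim_row (array_power (corner A) p q)" "j < dim_col (array_power (corner A) p q)"
    hence ij: "i < dim_row A" "j < dim_col A" using p q by (simp_all add: r_def c_def)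
    have mod: "i mod r < r" "j mod c < c" using r(2) c(2) by simp_all
    hence "i mod r < dim_row A" "j mod c < dim_col A" using r(4) c(4) by linarith+
    hence "A $$ (i mod r, j) = A $$ (i mod r, j mod c)"
      using row_period_mod[OF c(1), of j "i mod r"] ij by simp
    with row_period_mod[OF r(1) ij] have "A $$ (i, j) = A $$ (i mod r, j mod c)" by simp
    thus "A $$ (i, j) = array_power (corner A) p q $$ (i, j)"
      using ij mod p q by (simp add: corner_def flip: r_def c_def)
  qed (simp_all add: p q r_def c_def)
  ultimately show ?thesis by blast
qed

lemma corner_array_power_exponent:
  assumes "nonempty_array A" "corner A = array_power B p q"
  shows "p = 1"
proof -
  obtain i j where "A = array_power (corner A) i j"
    using ex_array_power_corner[OF assms(1)] by blast
  hence "A = array_power B (i * p) (j * q)" using assms(2) by (simp add: array_power_array_power)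
  hence "row_period A (dim_row B)" using row_period_array_power assms(1) by metis
  hence "least_row_period A \<le> dim_row B" unfolding least_row_period_def by (rule Least_le)
  moreover have "least_row_period A = p * dim_row B"
    using arg_cong[OF assms(2), of dim_row] by simp
  ultimately show "p = 1" using least_row_period(2)[OF assms(1)] by (cases p) auto
qed

lemma primitive_corner:
  assumes "nonempty_array A"
  shows "primitive_array (corner A)"
  unfolding primitive_array_def
proof (intro conjI allI impI)
  show "nonempty_array (corner A)"
    using least_row_period(2)[OF assms] least_col_period(2)[OF assms]
    by (simp add: nonempty_array_def)
  fix B and p q :: nat assume pq: "0 < p" "0 < q" "corner A = array_power B p q"
  show "p = 1" using corner_array_power_exponent[OF assms pq(3)] .
  have "corner (transpose_mat A) = array_power (transpose_mat B) q p"
    using pq(3) by (simp add: corner_transpose[OF assms] transpose_array_power)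
  thus "q = 1" by (rule corner_array_power_exponent[OF nonempty_array_transpose[OF assms]])
qed

lemma primitive_root_eqI:
  assumes "primitive_array C" "0 < i" "0 < j" "A = array_power C i j" "nonempty_array A"
  shows "primitive_root A = C"
  unfolding primitive_root_def
  by (rule the1_equality[OF primitive_root_ex1]) (use assms in blast)+

lemma primitive_root_eq_corner: "nonempty_array A \<Longrightarrow> primitive_root A = corner A"
  using primitive_root_eqI primitive_corner ex_array_power_corner by metis

lemma primitive_array_iff_least_periods:
  assumes "nonempty_array A"
  shows "primitive_array A \<longleftrightarrow> least_row_period A = dim_row A \<and> least_col_period A = dim_col A"
proof
  assume "primitive_array A"
  hence "primitive_root A = A"
    using primitive_root_eqI[of A 1 1 A] assms by (simp add: array_power_1_1)
  hence "corner A = A" using primitive_root_eq_corner[OF assms] by simp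
  thus "least_row_period A = dim_row A \<and> least_col_period A = dim_col A" using dim_corner by metis
next
  assume "least_row_period A = dim_row A \<and> least_col_period A = dim_col A"
  hence "corner A = A" unfolding corner_def by (intro eq_matI) auto
  thus "primitive_array A" using primitive_corner[OF assms] by simp
qed

definition row_major :: "'a mat \<Rightarrow> nat \<Rightarrow> 'a" where
  "row_major A k = A $$ (k div dim_col A, k mod dim_col A)"

lemma row_major_index: "j < dim_col A \<Longrightarrow> row_major A (i * dim_col A + j) = A $$ (i, j)"
  by (simp add: row_major_def)

lemma row_major_index_less:
  assumes "i < m" "j < n"
  shows "i * n + j < m * (n :: nat)"
proof -
  have "i * n + j < (i + 1) * n" using assms(2) by simp
  also have "\<dots> \<le> m * n" using assms(1) by (intro mult_le_mono1) simp
  finally show ?thesis .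
qed

lemma row_major_in_elements_mat:
  assumes "k < dim_row A * dim_col A"
  shows "row_major A k \<in> elements_mat A"
proof -
  have "0 < dim_col A" using assms by (auto intro: Nat.gr0I)
  thus ?thesis using assms unfolding row_major_def
    by (intro elements_matI[of A "dim_row A" "dim_col A"]) (auto intro: less_mult_imp_div_less)
qed

lemma row_period_iff_has_period:
  "row_period A d \<longleftrightarrow> 0 < d \<and> d dvd dim_row A \<and>
     has_period (row_major A) (dim_row A * dim_col A) (d * dim_col A)"
proof -
  let ?m = "dim_row A" and ?n = "dim_col A"
  have "has_period (row_major A) (?m * ?n) (d * ?n) \<longleftrightarrow>
        (\<forall>i j. d + i < ?m \<longrightarrow> j < ?n \<longrightarrow> A $$ (i, j) = A $$ (d + i, j))"
  proof (intro iffI allI impI)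
    fix i j assume per: "has_period (row_major A) (?m * ?n) (d * ?n)" and ij: "d + i < ?m" "j < ?n"
    have "(d + i) * ?n + j = d * ?n + (i * ?n + j)" by (simp add: algebra_simps)
    with row_major_index_less[OF ij] per
    have "row_major A (i * ?n + j) = row_major A ((d + i) * ?n + j)"
      unfolding has_period_def by metis
    thus "A $$ (i, j) = A $$ (d + i, j)" using ij(2) by (simp only: row_major_index)
  next
    assume rows: "\<forall>i j. d + i < ?m \<longrightarrow> j < ?n \<longrightarrow> A $$ (i, j) = A $$ (d + i, j)"
    show "has_period (row_major A) (?m * ?n) (d * ?n)"
      unfolding has_period_def
    proof (intro allI impI)
      fix t assume t: "d * ?n + t < ?m * ?n"
      hence "0 < ?n" by (auto intro: Nat.gr0I)
      hence split: "(d * ?n + t) div ?n = d + t div ?n" "(d * ?n + t) mod ?n = t mod ?n" by simp_all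
      have "d + t div ?n < ?m" using less_mult_imp_div_less[OF t] by (simp only: split)
      thus "row_major A t = row_major A (d * ?n + t)"
        using rows \<open>0 < ?n\<close> by (simp add: row_major_def split)
    qed
  qed
  thus ?thesis by (simp add: row_period_def)
qed

lemma least_row_period_eq_Least:
  assumes "inj_on f (elements_mat A)"
    and "\<And>k. k < dim_row A * dim_col A \<Longrightarrow> x k = f (row_major A k)"
  shows "least_row_period A =
    (LEAST d. 0 < d \<and> d dvd dim_row A \<and> has_period x (dim_row A * dim_col A) (d * dim_col A))"
proof -
  have "inj_on f (row_major A ` {..<dim_row A * dim_col A})"
    using assms(1) by (rule inj_on_subset) (use row_major_in_elements_mat in blast)
  hence "has_period x (dim_row A * dim_col A) d \<longleftrightarrow>
      has_period (row_major A) (dim_row A * dim_col A) d" for d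
    using has_period_cong[OF assms(2)] has_period_inj_on by simp
  thus ?thesis by (simp add: least_row_period_def row_period_iff_has_period)
qed

text \<open>
  Reads a stored array with \<open>P\<close> rows and \<open>Q\<close> columns column by column; for \<open>Q = 1\<close> this is the
  identity below \<open>P\<close>.
\<close>

definition strided_address :: "nat \<Rightarrow> nat \<Rightarrow> nat \<Rightarrow> nat" where
  "strided_address P Q k = (k mod P) * Q + k div P"

lemma strided_address_less:
  assumes "k < P * Q"
  shows "strided_address P Q k < P * Q"
proof -
  have "k div P < Q" using assms by (metis less_mult_imp_div_less mult.commute)
  moreover have "0 < P" using assms by (auto intro: Nat.gr0I)
  ultimately show ?thesis unfolding strided_address_def by (intro row_major_index_less) simp_all
qed

lemma strided_address_le:
  assumes "k \<le> P * Q" "0 < P"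
  shows "strided_address P Q k \<le> P * Q"
proof (cases "k = P * Q")
  case True
  thus ?thesis using assms(2) by (simp add: strided_address_def Suc_leI)
next
  case False
  thus ?thesis using strided_address_less[of k P Q] assms(1) by simp
qed

lemma row_major_transpose:
  assumes "k < dim_row A * dim_col A"
  shows "row_major (transpose_mat A) k = row_major A (strided_address (dim_row A) (dim_col A) k)"
proof -
  have "k div dim_row A < dim_col A" using assms by (metis less_mult_imp_div_less mult.commute)
  moreover have "0 < dim_row A" using assms by (auto intro: Nat.gr0I)
  ultimately show ?thesis unfolding strided_address_def row_major_index by (simp add: row_major_def)
qed

text \<open>Where the \<open>k\<close>-th entry of a corner with \<open>c\<close> columns is found in an array with \<open>n\<close> columns.\<close>

definition corner_address :: "nat \<Rightarrow> nat \<Rightarrow> nat \<Rightarrow> nat" where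
  "corner_address c n k = k div c * n + k mod c"

lemma corner_address_ge:
  assumes "c \<le> n"
  shows "k \<le> corner_address c n k"
proof -
  have "k = k div c * c + k mod c" by simp
  also have "\<dots> \<le> corner_address c n k"
    unfolding corner_address_def using assms by (intro add_le_mono1 mult_le_mono2)
  finally show ?thesis .
qed

lemma corner_address_less:
  assumes "k < r * c" "r \<le> m" "0 < c" "c \<le> n"
  shows "corner_address c n k < m * n"
  unfolding corner_address_def
proof (rule row_major_index_less)
  show "k div c < m" using less_mult_imp_div_less[OF assms(1)] assms(2) by linarith
  show "k mod c < n" using assms(3,4) by (meson less_le_trans mod_less_divisor)
qed

lemma row_major_corner:
  assumes "nonempty_array A" "k < least_row_period A * least_col_period A"
  shows "row_major (corner A) k = row_major A (corner_address (least_col_period A) (dim_col A) k)"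
proof -
  have "k div least_col_period A < least_row_period A"
    using assms(2) by (rule less_mult_imp_div_less)
  moreover have "k mod least_col_period A < least_col_period A"
    using least_col_period(2)[OF assms(1)] by simp
  moreover from this have "k mod least_col_period A < dim_col A"
    using least_col_period(4)[OF assms(1)] by linarith
  ultimately show ?thesis
    unfolding corner_address_def row_major_index by (simp add: row_major_def corner_def)
qed



section \<open>A while language with costs\<close>

datatype aop = Op_Add | Op_Sub | Op_Mul | Op_Div | Op_Mod

datatype 'v aexp =
    Lit nat
  | V 'v
  | Read "'v aexp"
  | Op aop "'v aexp" "'v aexp"

abbreviation add_aexp (infixl \<open>\<^bold>+\<close> 65) where "e \<^bold>+ f \<equiv> Op Op_Add e f"
abbreviation sub_aexp (infixl \<open>\<^bold>-\<close> 65) where "e \<^bold>- f \<equiv> Op Op_Sub e f"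
abbreviation mul_aexp (infixl \<open>\<^bold>*\<close> 70) where "e \<^bold>* f \<equiv> Op Op_Mul e f"
abbreviation div_aexp (infixl \<open>DIV\<close> 70) where "e DIV f \<equiv> Op Op_Div e f"
abbreviation mod_aexp (infixl \<open>MOD\<close> 70) where "e MOD f \<equiv> Op Op_Mod e f"

datatype 'v bexp =
    Less "'v aexp" "'v aexp" (infix \<open>\<^bold><\<close> 50)
  | Eq "'v aexp" "'v aexp" (infix \<open>\<^bold>=\<close> 50)
  | And "'v bexp" "'v bexp" (infixr \<open>\<^bold>\<and>\<close> 35)
  | Not "'v bexp" (\<open>\<^bold>\<not> _\<close> [40] 40)

datatype 'v com =
    Skip (\<open>SKIP\<close>)
  | Assign 'v "'v aexp" (infix \<open>::=\<close> 61)
  | Write "'v aexp" "'v aexp" (\<open>MEM[_] ::= _\<close> [0, 61] 61)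
  | Seq "'v com" "'v com" (infixr \<open>;;\<close> 60)
  | Cond "'v bexp" "'v com" "'v com" (\<open>IF _ THEN _ ELSE _\<close> [0, 0, 61] 61)
  | While "'v bexp" "'v com" (\<open>WHILE _ DO _\<close> [0, 61] 61)

type_synonym 'v store = "'v \<Rightarrow> nat"
type_synonym memory = "nat \<Rightarrow> nat"

fun apply_op :: "aop \<Rightarrow> nat \<Rightarrow> nat \<Rightarrow> nat" where
  "apply_op Op_Add x y = x + y"
| "apply_op Op_Sub x y = x - y"
| "apply_op Op_Mul x y = x * y"
| "apply_op Op_Div x y = x div y"
| "apply_op Op_Mod x y = x mod y"

fun aval :: "'v aexp \<Rightarrow> 'v store \<Rightarrow> memory \<Rightarrow> nat" where
  "aval (Lit n) \<sigma> \<mu> = n"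
| "aval (V x) \<sigma> \<mu> = \<sigma> x"
| "aval (Read e) \<sigma> \<mu> = \<mu> (aval e \<sigma> \<mu>)"
| "aval (Op op e f) \<sigma> \<mu> = apply_op op (aval e \<sigma> \<mu>) (aval f \<sigma> \<mu>)"

fun bval :: "'v bexp \<Rightarrow> 'v store \<Rightarrow> memory \<Rightarrow> bool" where
  "bval (e \<^bold>< f) \<sigma> \<mu> \<longleftrightarrow> aval e \<sigma> \<mu> < aval f \<sigma> \<mu>"
| "bval (e \<^bold>= f) \<sigma> \<mu> \<longleftrightarrow> aval e \<sigma> \<mu> = aval f \<sigma> \<mu>"
| "bval (b \<^bold>\<and> c) \<sigma> \<mu> \<longleftrightarrow> bval b \<sigma> \<mu> \<and> bval c \<sigma> \<mu>"
| "bval (\<^bold>\<not> b) \<sigma> \<mu> \<longleftrightarrow> \<not> bval b \<sigma> \<mu>"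

text \<open>The result of any other operation is at most its first argument.\<close>

fun op_fits :: "nat \<Rightarrow> aop \<Rightarrow> nat \<Rightarrow> nat \<Rightarrow> bool" where
  "op_fits w Op_Add x y \<longleftrightarrow> x + y < 2 ^ w"
| "op_fits w Op_Mul x y \<longleftrightarrow> x * y < 2 ^ w"
| "op_fits w _ x y \<longleftrightarrow> True"

fun aexp_fits :: "nat \<Rightarrow> 'v aexp \<Rightarrow> 'v store \<Rightarrow> memory \<Rightarrow> bool" where
  "aexp_fits w (Lit n) \<sigma> \<mu> \<longleftrightarrow> n < 2 ^ w"
| "aexp_fits w (V x) \<sigma> \<mu> \<longleftrightarrow> True"
| "aexp_fits w (Read e) \<sigma> \<mu> \<longleftrightarrow> aexp_fits w e \<sigma> \<mu>"
| "aexp_fits w (Op op e f) \<sigma> \<mu> \<longleftrightarrow>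
     aexp_fits w e \<sigma> \<mu> \<and> aexp_fits w f \<sigma> \<mu> \<and> op_fits w op (aval e \<sigma> \<mu>) (aval f \<sigma> \<mu>)"

text \<open>A conjunction always evaluates both of its arguments.\<close>

fun bexp_fits :: "nat \<Rightarrow> 'v bexp \<Rightarrow> 'v store \<Rightarrow> memory \<Rightarrow> bool" where
  "bexp_fits w (e \<^bold>< f) \<sigma> \<mu> \<longleftrightarrow> aexp_fits w e \<sigma> \<mu> \<and> aexp_fits w f \<sigma> \<mu>"
| "bexp_fits w (e \<^bold>= f) \<sigma> \<mu> \<longleftrightarrow> aexp_fits w e \<sigma> \<mu> \<and> aexp_fits w f \<sigma> \<mu>"
| "bexp_fits w (b \<^bold>\<and> c) \<sigma> \<mu> \<longleftrightarrow> bexp_fits w b \<sigma> \<mu> \<and> bexp_fits w c \<sigma> \<mu>"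
| "bexp_fits w (\<^bold>\<not> b) \<sigma> \<mu> \<longleftrightarrow> bexp_fits w b \<sigma> \<mu>"

fun op_cost :: "aop \<Rightarrow> nat" where
  "op_cost Op_Mod = 3"
| "op_cost _ = 1"

fun aexp_cost :: "'v aexp \<Rightarrow> nat" where
  "aexp_cost (Lit n) = 1"
| "aexp_cost (V x) = 2"
| "aexp_cost (Read e) = aexp_cost e + 1"
| "aexp_cost (Op op e f) = aexp_cost e + aexp_cost f + op_cost op"

fun bexp_cost :: "'v bexp \<Rightarrow> nat" where
  "bexp_cost (e \<^bold>< f) = aexp_cost e + aexp_cost f + 1"
| "bexp_cost (e \<^bold>= f) = aexp_cost e + aexp_cost f + 5"
| "bexp_cost (b \<^bold>\<and> c) = bexp_cost b + bexp_cost c + 2"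
| "bexp_cost (\<^bold>\<not> b) = bexp_cost b + 2"

inductive big_step ::
  "nat \<Rightarrow> 'v com \<Rightarrow> 'v store \<Rightarrow> memory \<Rightarrow> nat \<Rightarrow> 'v store \<Rightarrow> memory \<Rightarrow> bool" for w where
  Skip: "big_step w SKIP \<sigma> \<mu> 0 \<sigma> \<mu>"
| Assign: "aexp_fits w e \<sigma> \<mu> \<Longrightarrow>
    big_step w (x ::= e) \<sigma> \<mu> (aexp_cost e + 2) (\<sigma>(x := aval e \<sigma> \<mu>)) \<mu>"
| Write: "aexp_fits w e \<sigma> \<mu> \<Longrightarrow> aexp_fits w f \<sigma> \<mu> \<Longrightarrow>
    big_step w (MEM[e] ::= f) \<sigma> \<mu> (aexp_cost e + aexp_cost f + 1)
      \<sigma> (\<mu>(aval e \<sigma> \<mu> := aval f \<sigma> \<mu>))"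
| Seq: "big_step w c \<sigma> \<mu> t \<sigma>' \<mu>' \<Longrightarrow> big_step w d \<sigma>' \<mu>' u \<sigma>'' \<mu>'' \<Longrightarrow>
    big_step w (c ;; d) \<sigma> \<mu> (t + u) \<sigma>'' \<mu>''"
| Cond_True: "bexp_fits w b \<sigma> \<mu> \<Longrightarrow> bval b \<sigma> \<mu> \<Longrightarrow> big_step w c \<sigma> \<mu> t \<sigma>' \<mu>' \<Longrightarrow>
    big_step w (IF b THEN c ELSE d) \<sigma> \<mu> (bexp_cost b + 1 + t + 1) \<sigma>' \<mu>'"
| Cond_False: "bexp_fits w b \<sigma> \<mu> \<Longrightarrow> \<not> bval b \<sigma> \<mu> \<Longrightarrow> big_step w d \<sigma> \<mu> t \<sigma>' \<mu>' \<Longrightarrow>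
    big_step w (IF b THEN c ELSE d) \<sigma> \<mu> (bexp_cost b + 1 + t) \<sigma>' \<mu>'"
| While_False: "bexp_fits w b \<sigma> \<mu> \<Longrightarrow> \<not> bval b \<sigma> \<mu> \<Longrightarrow>
    big_step w (WHILE b DO c) \<sigma> \<mu> (bexp_cost b + 1) \<sigma> \<mu>"
| While_True: "bexp_fits w b \<sigma> \<mu> \<Longrightarrow> bval b \<sigma> \<mu> \<Longrightarrow> big_step w c \<sigma> \<mu> t \<sigma>' \<mu>' \<Longrightarrow>
    big_step w (WHILE b DO c) \<sigma>' \<mu>' u \<sigma>'' \<mu>'' \<Longrightarrow>
    big_step w (WHILE b DO c) \<sigma> \<mu> (bexp_cost b + 1 + t + 1 + u) \<sigma>'' \<mu>''"

fun assigned :: "'v com \<Rightarrow> 'v set" where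
  "assigned SKIP = {}"
| "assigned (x ::= e) = {x}"
| "assigned (MEM[e] ::= f) = {}"
| "assigned (c ;; d) = assigned c \<union> assigned d"
| "assigned (IF b THEN c ELSE d) = assigned c \<union> assigned d"
| "assigned (WHILE b DO c) = assigned c"

lemma big_step_unassigned: "big_step w c \<sigma> \<mu> t \<sigma>' \<mu>' \<Longrightarrow> x \<notin> assigned c \<Longrightarrow> \<sigma>' x = \<sigma> x"
  by (induction rule: big_step.induct) auto


section \<open>Weakest preconditions with time credits\<close>

text \<open>The last argument of a postcondition is the number of steps that may still be spent.\<close>

type_synonym 'v assertion = "'v store \<Rightarrow> memory \<Rightarrow> nat \<Rightarrow> bool"

definition wp :: "nat \<Rightarrow> 'v com \<Rightarrow> 'v assertion \<Rightarrow> 'v assertion" where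
  "wp w c Q \<sigma> \<mu> k \<longleftrightarrow> (\<exists>t \<sigma>' \<mu>'. big_step w c \<sigma> \<mu> t \<sigma>' \<mu>' \<and> t \<le> k \<and> Q \<sigma>' \<mu>' (k - t))"

lemma wp_mono:
  assumes "wp w c Q \<sigma> \<mu> k"
    and "\<And>\<sigma>' \<mu>' k'. (\<And>x. x \<notin> assigned c \<Longrightarrow> \<sigma>' x = \<sigma> x) \<Longrightarrow> Q \<sigma>' \<mu>' k' \<Longrightarrow> Q' \<sigma>' \<mu>' k'"
  shows "wp w c Q' \<sigma> \<mu> k"
  using assms big_step_unassigned unfolding wp_def by metis

inductive_simps big_step_simps:
  "big_step w SKIP \<sigma> \<mu> t \<sigma>' \<mu>'"
  "big_step w (x ::= e) \<sigma> \<mu> t \<sigma>' \<mu>'"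
  "big_step w (MEM[e] ::= f) \<sigma> \<mu> t \<sigma>' \<mu>'"
  "big_step w (c ;; d) \<sigma> \<mu> t \<sigma>' \<mu>'"

lemma wp_Skip [simp]: "wp w SKIP Q \<sigma> \<mu> k \<longleftrightarrow> Q \<sigma> \<mu> k"
  by (auto simp: wp_def big_step_simps)

lemma wp_Assign [simp]:
  "wp w (x ::= e) Q \<sigma> \<mu> k \<longleftrightarrow> aexp_fits w e \<sigma> \<mu> \<and> aexp_cost e + 2 \<le> k \<and>
     Q (\<sigma>(x := aval e \<sigma> \<mu>)) \<mu> (k - (aexp_cost e + 2))"
  by (auto simp: wp_def big_step_simps)

lemma wp_Write [simp]:
  "wp w (MEM[e] ::= f) Q \<sigma> \<mu> k \<longleftrightarrow> aexp_fits w e \<sigma> \<mu> \<and> aexp_fits w f \<sigma> \<mu> \<and>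
     aexp_cost e + aexp_cost f + 1 \<le> k \<and>
     Q \<sigma> (\<mu>(aval e \<sigma> \<mu> := aval f \<sigma> \<mu>)) (k - (aexp_cost e + aexp_cost f + 1))"
  by (auto simp: wp_def big_step_simps)

lemma wp_Seq [simp]: "wp w (c ;; d) Q \<sigma> \<mu> k \<longleftrightarrow> wp w c (wp w d Q) \<sigma> \<mu> k"
proof
  assume "wp w (c ;; d) Q \<sigma> \<mu> k"
  then obtain t \<sigma>1 \<mu>1 u \<sigma>2 \<mu>2 where "big_step w c \<sigma> \<mu> t \<sigma>1 \<mu>1" "big_step w d \<sigma>1 \<mu>1 u \<sigma>2 \<mu>2"
    "t + u \<le> k" "Q \<sigma>2 \<mu>2 (k - (t + u))"
    by (auto simp: wp_def big_step_simps)
  moreover from this have "t \<le> k" "u \<le> k - t" "Q \<sigma>2 \<mu>2 (k - t - u)" by simp_all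
  ultimately show "wp w c (wp w d Q) \<sigma> \<mu> k" unfolding wp_def by blast
next
  assume "wp w c (wp w d Q) \<sigma> \<mu> k"
  then obtain t \<sigma>1 \<mu>1 u \<sigma>2 \<mu>2 where run: "big_step w c \<sigma> \<mu> t \<sigma>1 \<mu>1" "big_step w d \<sigma>1 \<mu>1 u \<sigma>2 \<mu>2"
    and "t \<le> k" "u \<le> k - t" "Q \<sigma>2 \<mu>2 (k - t - u)"
    by (auto simp: wp_def)
  hence "t + u \<le> k" "Q \<sigma>2 \<mu>2 (k - (t + u))" by simp_all
  thus "wp w (c ;; d) Q \<sigma> \<mu> k" unfolding wp_def using big_step.Seq[OF run] by blast
qed

lemma wp_CondI:
  assumes "bexp_fits w b \<sigma> \<mu>" "bexp_cost b + 1 \<le> k"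
    and "bval b \<sigma> \<mu> \<Longrightarrow>
      wp w c (\<lambda>\<sigma> \<mu> k. 1 \<le> k \<and> Q \<sigma> \<mu> (k - 1)) \<sigma> \<mu> (k - (bexp_cost b + 1))"
    and "\<not> bval b \<sigma> \<mu> \<Longrightarrow> wp w d Q \<sigma> \<mu> (k - (bexp_cost b + 1))"
  shows "wp w (IF b THEN c ELSE d) Q \<sigma> \<mu> k"
proof (cases "bval b \<sigma> \<mu>")
  case True
  then obtain t \<sigma>' \<mu>' where "big_step w c \<sigma> \<mu> t \<sigma>' \<mu>'" "t \<le> k - (bexp_cost b + 1)"
    "1 \<le> k - (bexp_cost b + 1) - t" "Q \<sigma>' \<mu>' (k - (bexp_cost b + 1) - t - 1)"
    using assms(3) unfolding wp_def by blast
  with True assms(1,2) show ?thesis unfolding wp_def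
    by (intro exI[of _ "bexp_cost b + 1 + t + 1"] exI[of _ \<sigma>'] exI[of _ \<mu>'])
      (auto intro: big_step.Cond_True[simplified])
next
  case False
  then obtain t \<sigma>' \<mu>' where "big_step w d \<sigma> \<mu> t \<sigma>' \<mu>'" "t \<le> k - (bexp_cost b + 1)"
    "Q \<sigma>' \<mu>' (k - (bexp_cost b + 1) - t)"
    using assms(4) unfolding wp_def by blast
  with False assms(1,2) show ?thesis unfolding wp_def
    by (intro exI[of _ "bexp_cost b + 1 + t"] exI[of _ \<sigma>'] exI[of _ \<mu>'])
      (auto intro: big_step.Cond_False[simplified])
qed

text \<open>No variant is needed, because every iteration spends credits.\<close>

lemma wp_While:
  assumes inv: "I \<sigma> \<mu> k"
    and test: "\<And>\<sigma>' \<mu>' k'. (\<And>x. x \<notin> assigned c \<Longrightarrow> \<sigma>' x = \<sigma> x) \<Longrightarrow> I \<sigma>' \<mu>' k' \<Longrightarrow>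
      bexp_fits w b \<sigma>' \<mu>' \<and> bexp_cost b + 1 \<le> k'"
    and body: "\<And>\<sigma>' \<mu>' k'. (\<And>x. x \<notin> assigned c \<Longrightarrow> \<sigma>' x = \<sigma> x) \<Longrightarrow> I \<sigma>' \<mu>' k' \<Longrightarrow>
      bval b \<sigma>' \<mu>' \<Longrightarrow>
      wp w c (\<lambda>\<sigma> \<mu> k. 1 \<le> k \<and> I \<sigma> \<mu> (k - 1)) \<sigma>' \<mu>' (k' - (bexp_cost b + 1))"
    and exit: "\<And>\<sigma>' \<mu>' k'. (\<And>x. x \<notin> assigned c \<Longrightarrow> \<sigma>' x = \<sigma> x) \<Longrightarrow> I \<sigma>' \<mu>' k' \<Longrightarrow>
      \<not> bval b \<sigma>' \<mu>' \<Longrightarrow> Q \<sigma>' \<mu>' (k' - (bexp_cost b + 1))"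
  shows "wp w (WHILE b DO c) Q \<sigma> \<mu> k"
proof -
  have "wp w (WHILE b DO c) Q \<sigma>' \<mu>' k'"
    if "\<And>x. x \<notin> assigned c \<Longrightarrow> \<sigma>' x = \<sigma> x" "I \<sigma>' \<mu>' k'" for \<sigma>' \<mu>' k'
    using that
  proof (induction k' arbitrary: \<sigma>' \<mu>' rule: less_induct)
    case (less k)
    note test = test[OF less.prems]
    show ?case
    proof (cases "bval b \<sigma>' \<mu>'")
      case True
      obtain t \<sigma>1 \<mu>1 where run: "big_step w c \<sigma>' \<mu>' t \<sigma>1 \<mu>1"
        and t: "bexp_cost b + 1 + t + 1 \<le> k" "I \<sigma>1 \<mu>1 (k - (bexp_cost b + 1 + t + 1))"
        using body[OF less.prems True] test unfolding wp_def by auto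
      have "\<sigma>1 x = \<sigma> x" if "x \<notin> assigned c" for x
        using big_step_unassigned[OF run that] less.prems(1)[OF that] by simp
      with t have "wp w (WHILE b DO c) Q \<sigma>1 \<mu>1 (k - (bexp_cost b + 1 + t + 1))"
        by (intro less.IH) simp_all
      then obtain u \<sigma>2 \<mu>2 where rest: "big_step w (WHILE b DO c) \<sigma>1 \<mu>1 u \<sigma>2 \<mu>2"
        and u: "u \<le> k - (bexp_cost b + 1 + t + 1)" "Q \<sigma>2 \<mu>2 (k - (bexp_cost b + 1 + t + 1) - u)"
        unfolding wp_def by blast
      have "big_step w (WHILE b DO c) \<sigma>' \<mu>' (bexp_cost b + 1 + t + 1 + u) \<sigma>2 \<mu>2"
        using test True run rest by (blast intro: big_step.While_True)
      moreover have "bexp_cost b + 1 + t + 1 + u \<le> k" using t u by linarith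
      ultimately show ?thesis using u(2) unfolding wp_def diff_diff_left by blast
    next
      case False
      thus ?thesis using test exit[OF less.prems False] big_step.While_False
        unfolding wp_def by blast
    qed
  qed
  thus ?thesis using inv by blast
qed


section \<open>Compilation to the random access machine\<close>

definition code_at :: "instr list \<Rightarrow> nat \<Rightarrow> instr list \<Rightarrow> bool" where
  "code_at P p xs \<longleftrightarrow> (\<forall>i<length xs. p + i < length P \<and> P ! (p + i) = xs ! i)"

lemma code_at_Nil [simp]: "code_at P p []"
  by (simp add: code_at_def)

lemma code_at_Cons [simp]:
  "code_at P p (x # xs) \<longleftrightarrow> p < length P \<and> P ! p = x \<and> code_at P (Suc p) xs"
  by (auto simp: code_at_def All_less_Suc2)

lemma code_at_append [simp]:
  "code_at P p (xs @ ys) \<longleftrightarrow> code_at P p xs \<and> code_at P (p + length xs) ys"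
  by (induction xs arbitrary: p) auto

text \<open>
  Variables live in the registers \<open>loc x < h\<close>. Expressions leave their value in register \<open>h\<close> and
  change only registers from \<open>h\<close> on; true is represented by any nonzero number. Jumps are absolute,
  so commands are compiled for the address \<open>p\<close> of their first instruction.
\<close>

fun op_code :: "nat \<Rightarrow> aop \<Rightarrow> instr list" where
  "op_code h Op_Add = [Add h h (h + 1)]"
| "op_code h Op_Sub = [Sub h h (h + 1)]"
| "op_code h Op_Mul = [Mul h h (h + 1)]"
| "op_code h Op_Div = [Div h h (h + 1)]"
| "op_code h Op_Mod = [Div (h + 2) h (h + 1), Mul (h + 2) (h + 2) (h + 1), Sub h h (h + 2)]"

fun aexp_code :: "('v \<Rightarrow> nat) \<Rightarrow> nat \<Rightarrow> 'v aexp \<Rightarrow> instr list" where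
  "aexp_code loc h (Lit n) = [Const h n]"
| "aexp_code loc h (V x) = [Const h 0, Add h h (loc x)]"
| "aexp_code loc h (Read e) = aexp_code loc h e @ [Load h h]"
| "aexp_code loc h (Op op e f) = aexp_code loc h e @ aexp_code loc (h + 1) f @ op_code h op"

fun bexp_code :: "('v \<Rightarrow> nat) \<Rightarrow> nat \<Rightarrow> 'v bexp \<Rightarrow> instr list" where
  "bexp_code loc h (e \<^bold>< f) = aexp_code loc h f @ aexp_code loc (h + 1) e @ [Sub h h (h + 1)]"
| "bexp_code loc h (e \<^bold>= f) = aexp_code loc h e @ aexp_code loc (h + 1) f @
     [Sub (h + 2) h (h + 1), Sub h (h + 1) h, Add h h (h + 2), Const (h + 1) 1, Sub h (h + 1) h]"
| "bexp_code loc h (b \<^bold>\<and> c) = bexp_code loc h b @ bexp_code loc (h + 1) c @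
     [Sub (h + 1) h (h + 1), Sub h h (h + 1)]"
| "bexp_code loc h (\<^bold>\<not> b) = bexp_code loc h b @ [Const (h + 1) 1, Sub h (h + 1) h]"

fun com_size :: "'v com \<Rightarrow> nat" where
  "com_size SKIP = 0"
| "com_size (x ::= e) = aexp_cost e + 2"
| "com_size (MEM[e] ::= f) = aexp_cost e + aexp_cost f + 1"
| "com_size (c ;; d) = com_size c + com_size d"
| "com_size (IF b THEN c ELSE d) = bexp_cost b + com_size c + com_size d + 2"
| "com_size (WHILE b DO c) = bexp_cost b + com_size c + 2"

fun com_code :: "('v \<Rightarrow> nat) \<Rightarrow> nat \<Rightarrow> nat \<Rightarrow> 'v com \<Rightarrow> instr list" where
  "com_code loc h p SKIP = []"
| "com_code loc h p (x ::= e) = aexp_code loc h e @ [Const (h + 1) 0, Add (loc x) h (h + 1)]"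
| "com_code loc h p (MEM[e] ::= f) =
     aexp_code loc h e @ aexp_code loc (h + 1) f @ [Store h (h + 1)]"
| "com_code loc h p (c ;; d) = com_code loc h p c @ com_code loc h (p + com_size c) d"
| "com_code loc h p (IF b THEN c ELSE d) =
     (let q = p + bexp_cost b + 1; r = q + com_size c + 1 in
      bexp_code loc h b @ [JumpZ h r] @ com_code loc h q c @
      [Jump (r + com_size d)] @ com_code loc h r d)"
| "com_code loc h p (WHILE b DO c) =
     (let q = p + bexp_cost b + 1 in
      bexp_code loc h b @ [JumpZ h (q + com_size c + 1)] @ com_code loc h q c @ [Jump p])"

lemma length_op_code [simp]: "length (op_code h op) = op_cost op"
  by (cases op) simp_all

lemma length_aexp_code [simp]: "length (aexp_code loc h e) = aexp_cost e"
  by (induction e arbitrary: h) simp_all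

lemma length_bexp_code [simp]: "length (bexp_code loc h b) = bexp_cost b"
  by (induction b arbitrary: h) simp_all

lemma length_com_code [simp]: "length (com_code loc h p c) = com_size c"
  by (induction c arbitrary: p) (simp_all add: Let_def)

lemma set_reg_simps [simp]:
  "pc (set_reg a v s) = Suc (pc s)"
  "reg (set_reg a v s) = (reg s)(a := v)"
  "mem (set_reg a v s) = mem s"
  by (simp_all add: set_reg_def)

lemma fits_set_reg [simp]: "fits w s \<Longrightarrow> fits w (set_reg a v s) \<longleftrightarrow> v < 2 ^ w"
  by (auto simp: fits_def)

lemma fits_set_pc [simp]: "fits w (s\<lparr>pc := p\<rparr>) \<longleftrightarrow> fits w s"
  by (simp add: fits_def)

lemma fits_set_mem:
  "fits w s \<Longrightarrow> mem s = \<mu> \<Longrightarrow> v < 2 ^ w \<Longrightarrow> fits w (s\<lparr>pc := p, mem := \<mu>(a := v)\<rparr>)"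
  by (auto simp: fits_def)

lemma reg_less_two_power [simp]: "fits w s \<Longrightarrow> reg s a < 2 ^ w"
  by (simp add: fits_def)

lemma mem_less_two_power [simp]: "fits w s \<Longrightarrow> mem s a < 2 ^ w"
  by (simp add: fits_def)

lemma diff_less_two_power [simp]: "x < 2 ^ w \<Longrightarrow> x - y < 2 ^ w" for x y :: nat
  by (rule le_less_trans) simp_all

lemma div_less_two_power [simp]: "x < 2 ^ w \<Longrightarrow> x div y < 2 ^ w" for x y :: nat
  by (rule le_less_trans[OF div_le_dividend])

definition scratch_run :: "instr list \<Rightarrow> nat \<Rightarrow> nat \<Rightarrow> nat \<Rightarrow> config \<Rightarrow> config \<Rightarrow> bool" where
  "scratch_run P w h t s s' \<longleftrightarrow> (ram_step P w ^^ t) s s' \<and> fits w s' \<and> pc s' = pc s + t \<and>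
     mem s' = mem s \<and> (\<forall>a<h. reg s' a = reg s a)"

lemma scratch_run_trans:
  assumes "scratch_run P w h t s s'" "scratch_run P w h' u s' s''" "h \<le> h'"
  shows "scratch_run P w h (t + u) s s''"
  using assms unfolding scratch_run_def by (auto intro: relpowp_trans)

fun scratch_code :: "nat \<Rightarrow> nat \<Rightarrow> instr list \<Rightarrow> config \<Rightarrow> bool" where
  "scratch_code w h [] s \<longleftrightarrow> True"
| "scratch_code w h (i # xs) s \<longleftrightarrow> (let s' = exec_instr i s in
     fits w s' \<and> pc s' = Suc (pc s) \<and> mem s' = mem s \<and> (\<forall>a<h. reg s' a = reg s a) \<and>
     scratch_code w h xs s')"

lemma scratch_run_fold:
  assumes "code_at P (pc s) xs" "scratch_code w h xs s" "fits w s"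
  shows "scratch_run P w h (length xs) s (fold exec_instr xs s)"
  using assms
proof (induction xs arbitrary: s)
  case (Cons i xs)
  have "scratch_run P w h 1 s (exec_instr i s)"
    using Cons.prems by (auto simp: scratch_run_def ram_step_def Let_def)
  moreover have "scratch_run P w h (length xs) (exec_instr i s) (fold exec_instr (i # xs) s)"
    using Cons by (simp add: Let_def)
  ultimately have "scratch_run P w h (1 + length xs) s (fold exec_instr (i # xs) s)"
    by (rule scratch_run_trans) simp
  thus ?case by simp
qed (simp add: scratch_run_def)

lemma scratch_run_append:
  assumes "scratch_run P w h t s s'" "code_at P (pc s + t) xs" "scratch_code w h xs s'"
  shows "scratch_run P w h (t + length xs) s (fold exec_instr xs s')"
  using assms scratch_run_fold[of P s' xs w h] scratch_run_trans
  by (fastforce simp: scratch_run_def)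

lemma scratch_run_operands:
  assumes "scratch_run P w h t s s'" "scratch_run P w (h + 1) u s' s''"
  shows "scratch_run P w h (t + u) s s''" "reg s'' h = reg s' h"
proof -
  show "scratch_run P w h (t + u) s s''" using scratch_run_trans[OF assms] by simp
  show "reg s'' h = reg s' h" using assms(2) by (simp add: scratch_run_def)
qed

lemma op_code_correct:
  assumes "code_at P (pc s) (op_code h op)" "fits w s" "op_fits w op (reg s h) (reg s (h + 1))"
  shows "\<exists>s'. scratch_run P w h (op_cost op) s s' \<and>
    reg s' h = apply_op op (reg s h) (reg s (h + 1))"
proof -
  have "x div y * y < 2 ^ w" if "x < 2 ^ w" for x y :: nat
    using div_times_less_eq_dividend that by (rule le_less_trans)
  hence "scratch_code w h (op_code h op) s"
    using assms(2,3) by (cases op) (simp_all add: Let_def)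
  from scratch_run_fold[OF assms(1) this assms(2)]
  have "scratch_run P w h (op_cost op) s (fold exec_instr (op_code h op) s)" by simp
  moreover have "reg (fold exec_instr (op_code h op) s) h = apply_op op (reg s h) (reg s (h + 1))"
    by (cases op) (simp_all add: minus_div_mult_eq_mod)
  ultimately show ?thesis by blast
qed

definition represents :: "nat \<Rightarrow> ('v \<Rightarrow> nat) \<Rightarrow> config \<Rightarrow> 'v store \<Rightarrow> memory \<Rightarrow> bool" where
  "represents w loc s \<sigma> \<mu> \<longleftrightarrow> fits w s \<and> (\<forall>x. reg s (loc x) = \<sigma> x) \<and> mem s = \<mu>"

lemma represents_less_two_power: "represents w loc s \<sigma> \<mu> \<Longrightarrow> \<sigma> x < 2 ^ w"
  unfolding represents_def by (metis reg_less_two_power)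

lemma represents_scratch_run:
  assumes "represents w loc s \<sigma> \<mu>" "scratch_run P w h t s s'" "\<And>x. loc x < h"
  shows "represents w loc s' \<sigma> \<mu>"
  using assms by (simp add: represents_def scratch_run_def)

lemma var_code_correct:
  assumes "represents w loc s \<sigma> \<mu>" "loc x < h" "code_at P (pc s) (aexp_code loc h (V x))"
  shows "\<exists>s'. scratch_run P w h 2 s s' \<and> reg s' h = \<sigma> x"
proof -
  let ?code = "aexp_code loc h (V x)"
  have "scratch_code w h ?code s" "reg (fold exec_instr ?code s) h = \<sigma> x"
    using assms(1,2) represents_less_two_power[OF assms(1)] by (auto simp: represents_def Let_def)
  moreover have "length ?code = 2" by simp
  ultimately show ?thesis
    using scratch_run_fold[OF assms(3), of w h] assms(1) unfolding represents_def by metis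
qed

lemma aexp_code_correct:
  assumes "represents w loc s \<sigma> \<mu>" "\<And>x. loc x < h"
    and "code_at P (pc s) (aexp_code loc h e)" "aexp_fits w e \<sigma> \<mu>"
  shows "\<exists>s'. scratch_run P w h (aexp_cost e) s s' \<and> reg s' h = aval e \<sigma> \<mu>"
  using assms
proof (induction e arbitrary: s h)
  case (Lit n)
  thus ?case using scratch_run_fold[of P s "[Const h n]" w h] by (force simp: represents_def)
next
  case (V x)
  show ?case using var_code_correct[OF V.prems(1,2,3)] by simp
next
  case (Read e)
  obtain s1 where s1: "scratch_run P w h (aexp_cost e) s s1" "reg s1 h = aval e \<sigma> \<mu>"
    using Read.IH[OF Read.prems(1,2)] Read.prems(3,4) by auto
  have rep: "represents w loc s1 \<sigma> \<mu>"
    using represents_scratch_run[OF Read.prems(1) s1(1) Read.prems(2)] .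
  have "scratch_run P w h (aexp_cost e + length [Load h h]) s (fold exec_instr [Load h h] s1)"
    using Read.prems(3) rep
    by (intro scratch_run_append[OF s1(1)]) (auto simp: represents_def Let_def)
  with rep s1(2) show ?case by (force simp: represents_def)
next
  case (Op op e f)
  obtain s1 where s1: "scratch_run P w h (aexp_cost e) s s1" "reg s1 h = aval e \<sigma> \<mu>"
    using Op.IH(1)[OF Op.prems(1,2)] Op.prems(3,4) by auto
  have rep: "represents w loc s1 \<sigma> \<mu>"
    using represents_scratch_run[OF Op.prems(1) s1(1) Op.prems(2)] .
  obtain s2 where s2: "scratch_run P w (h + 1) (aexp_cost f) s1 s2" "reg s2 (h + 1) = aval f \<sigma> \<mu>"
    using Op.IH(2)[OF rep, of "h + 1"] Op.prems(2-4) s1(1)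
    by (auto simp: scratch_run_def less_Suc_eq)
  note run = scratch_run_operands[OF s1(1) s2(1)]
  then obtain s3 where "scratch_run P w h (op_cost op) s2 s3" "reg s3 h = aval (Op op e f) \<sigma> \<mu>"
    using op_code_correct[of P s2 h op w] Op.prems(3,4) s1 s2
    by (auto simp: scratch_run_def add.assoc)
  with scratch_run_trans[OF run(1)] show ?case by fastforce
qed

lemma aexp_code_pair_correct:
  assumes "represents w loc s \<sigma> \<mu>" "\<And>x. loc x < h"
    and "code_at P (pc s) (aexp_code loc h e @ aexp_code loc (h + 1) f)"
    and "aexp_fits w e \<sigma> \<mu>" "aexp_fits w f \<sigma> \<mu>"
  shows "\<exists>s'. scratch_run P w h (aexp_cost e + aexp_cost f) s s' \<and>
    reg s' h = aval e \<sigma> \<mu> \<and> reg s' (h + 1) = aval f \<sigma> \<mu>"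
proof -
  obtain s1 where s1: "scratch_run P w h (aexp_cost e) s s1" "reg s1 h = aval e \<sigma> \<mu>"
    using aexp_code_correct[OF assms(1,2), of P e] assms(3,4) by auto
  have "represents w loc s1 \<sigma> \<mu>" using represents_scratch_run[OF assms(1) s1(1) assms(2)] .
  then obtain s2 where s2: "scratch_run P w (h + 1) (aexp_cost f) s1 s2"
    "reg s2 (h + 1) = aval f \<sigma> \<mu>"
    using aexp_code_correct[of w loc s1 \<sigma> \<mu> "h + 1" P f] assms(2,3,5) s1(1)
    by (auto simp: scratch_run_def less_Suc_eq)
  thus ?thesis using scratch_run_operands[OF s1(1) s2(1)] s1(2) by auto
qed

lemma less_code_correct:
  assumes rep: "represents w loc s \<sigma> \<mu>" and loc: "\<And>x. loc x < h"
    and code: "code_at P (pc s) (bexp_code loc h (e \<^bold>< f))"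
    and fit: "bexp_fits w (e \<^bold>< f) \<sigma> \<mu>"
  shows "\<exists>s'. scratch_run P w h (bexp_cost (e \<^bold>< f)) s s' \<and> (reg s' h \<noteq> 0 \<longleftrightarrow> bval (e \<^bold>< f) \<sigma> \<mu>)"
proof -
  let ?code = "[Sub h h (h + 1)]"
  obtain s1 where s1: "scratch_run P w h (aexp_cost f + aexp_cost e) s s1"
    "reg s1 h = aval f \<sigma> \<mu>" "reg s1 (h + 1) = aval e \<sigma> \<mu>"
    using aexp_code_pair_correct[OF rep loc, of P f e] code fit by auto
  have "scratch_code w h ?code s1" using s1(1) by (simp add: scratch_run_def Let_def)
  hence "scratch_run P w h (aexp_cost f + aexp_cost e + length ?code) s (fold exec_instr ?code s1)"
    using code by (intro scratch_run_append[OF s1(1)]) (simp_all add: add.assoc)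
  thus ?thesis using s1(2,3)
    by (intro exI[of _ "fold exec_instr ?code s1"]) (auto simp: add.commute)
qed

lemma eq_code_correct:
  assumes rep: "represents w loc s \<sigma> \<mu>" and loc: "\<And>x. loc x < h"
    and code: "code_at P (pc s) (bexp_code loc h (e \<^bold>= f))"
    and fit: "bexp_fits w (e \<^bold>= f) \<sigma> \<mu>" "0 < w"
  shows "\<exists>s'. scratch_run P w h (bexp_cost (e \<^bold>= f)) s s' \<and> (reg s' h \<noteq> 0 \<longleftrightarrow> bval (e \<^bold>= f) \<sigma> \<mu>)"
proof -
  let ?code = "[Sub (h + 2) h (h + 1), Sub h (h + 1) h, Add h h (h + 2), Const (h + 1) 1,
    Sub h (h + 1) h]"
  obtain s1 where s1: "scratch_run P w h (aexp_cost e + aexp_cost f) s s1"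
    "reg s1 h = aval e \<sigma> \<mu>" "reg s1 (h + 1) = aval f \<sigma> \<mu>"
    using aexp_code_pair_correct[OF rep loc, of P e f] code fit by auto
  have "x - y + (y - x) < 2 ^ w" if "x < 2 ^ w" "y < 2 ^ w" for x y :: nat
    using that by linarith
  moreover have "1 < (2 :: nat) ^ w" using \<open>0 < w\<close> by (rule one_less_power[rotated]) simp
  ultimately have "scratch_code w h ?code s1"
    using s1(1) by (simp add: scratch_run_def Let_def)
  hence "scratch_run P w h (aexp_cost e + aexp_cost f + length ?code) s (fold exec_instr ?code s1)"
    using code by (intro scratch_run_append[OF s1(1)]) (simp_all add: add.assoc)
  thus ?thesis using s1(2,3)
    by (intro exI[of _ "fold exec_instr ?code s1"]) (auto simp: eval_nat_numeral)
qed

lemma bexp_code_correct: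
  assumes "represents w loc s \<sigma> \<mu>" "\<And>x. loc x < h" "0 < w"
    and "code_at P (pc s) (bexp_code loc h b)" "bexp_fits w b \<sigma> \<mu>"
  shows "\<exists>s'. scratch_run P w h (bexp_cost b) s s' \<and> (reg s' h \<noteq> 0 \<longleftrightarrow> bval b \<sigma> \<mu>)"
  using assms
proof (induction b arbitrary: s h)
  case (Less e f)
  show ?case using less_code_correct[OF Less.prems(1,2,4,5)] .
next
  case (Eq e f)
  show ?case using eq_code_correct[OF Eq.prems(1,2,4,5,3)] .
next
  case (And b c)
  let ?code = "[Sub (h + 1) h (h + 1), Sub h h (h + 1)]"
  obtain s1 where s1: "scratch_run P w h (bexp_cost b) s s1" "reg s1 h \<noteq> 0 \<longleftrightarrow> bval b \<sigma> \<mu>"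
    using And.IH(1)[OF And.prems(1,2,3)] And.prems(4,5) by auto
  have "represents w loc s1 \<sigma> \<mu>"
    using represents_scratch_run[OF And.prems(1) s1(1) And.prems(2)] .
  then obtain s2 where s2: "scratch_run P w (h + 1) (bexp_cost c) s1 s2"
    "reg s2 (h + 1) \<noteq> 0 \<longleftrightarrow> bval c \<sigma> \<mu>"
    using And.IH(2)[of s1 "h + 1"] And.prems(2-5) s1(1)
    by (auto simp: scratch_run_def less_Suc_eq)
  note run = scratch_run_operands[OF s1(1) s2(1)]
  have "scratch_code w h ?code s2" using run(1) by (simp add: scratch_run_def Let_def)
  with run s1 s2 show ?case
    using scratch_run_append[of P w h _ s s2 ?code] And.prems(4)
    by (intro exI[of _ "fold exec_instr ?code s2"]) (auto simp: add_ac)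
next
  case (Not b)
  let ?code = "[Const (h + 1) 1, Sub h (h + 1) h]"
  obtain s1 where s1: "scratch_run P w h (bexp_cost b) s s1" "reg s1 h \<noteq> 0 \<longleftrightarrow> bval b \<sigma> \<mu>"
    using Not.IH[OF Not.prems(1,2,3)] Not.prems(4,5) by auto
  moreover have "1 < (2 :: nat) ^ w" using Not.prems(3) by (rule one_less_power[rotated]) simp
  hence "scratch_code w h ?code s1"
    using s1(1) by (simp add: scratch_run_def Let_def)
  ultimately show ?case
    using scratch_run_append[of P w h _ s s1 ?code] Not.prems(4)
    by (intro exI[of _ "fold exec_instr ?code s1"]) auto
qed

lemma represents_set_pc [simp]:
  "represents w loc (s\<lparr>pc := p\<rparr>) \<sigma> \<mu> \<longleftrightarrow> represents w loc s \<sigma> \<mu>"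
  by (simp add: represents_def)

definition reaches ::
  "instr list \<Rightarrow> nat \<Rightarrow> ('v \<Rightarrow> nat) \<Rightarrow> nat \<Rightarrow> config \<Rightarrow> nat \<Rightarrow> 'v store \<Rightarrow> memory \<Rightarrow> bool" where
  "reaches P w loc t s p \<sigma> \<mu> \<longleftrightarrow>
     (\<exists>s'. (ram_step P w ^^ t) s s' \<and> pc s' = p \<and> represents w loc s' \<sigma> \<mu>)"

lemma reachesI:
  assumes "(ram_step P w ^^ t) s s'" "pc s' = p" "represents w loc s' \<sigma> \<mu>"
  shows "reaches P w loc t s p \<sigma> \<mu>"
  using assms unfolding reaches_def by blast

lemma reaches_trans:
  assumes "reaches P w loc t s p \<sigma> \<mu>"
    and "\<And>s'. pc s' = p \<Longrightarrow> represents w loc s' \<sigma> \<mu> \<Longrightarrow> reaches P w loc u s' q \<sigma>' \<mu>'"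
  shows "reaches P w loc (t + u) s q \<sigma>' \<mu>'"
  using assms relpowp_trans[of t "ram_step P w"] unfolding reaches_def by blast

lemma reaches_Jump:
  assumes "code_at P (pc s) [Jump l]" "represents w loc s \<sigma> \<mu>"
  shows "reaches P w loc 1 s l \<sigma> \<mu>"
proof (rule reachesI)
  show "(ram_step P w ^^ 1) s (s\<lparr>pc := l\<rparr>)"
    using assms by (simp add: ram_step_def represents_def eq_OO)
qed (use assms in simp_all)

lemma branch_correct:
  assumes rep: "represents w loc s \<sigma> \<mu>" and loc: "\<And>x. loc x < h" and "0 < w"
    and code: "code_at P (pc s) (bexp_code loc h b @ [JumpZ h l])" and fit: "bexp_fits w b \<sigma> \<mu>"
  shows "reaches P w loc (bexp_cost b + 1) s (if bval b \<sigma> \<mu> then pc s + bexp_cost b + 1 else l) \<sigma> \<mu>"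
proof -
  obtain s1 where s1: "scratch_run P w h (bexp_cost b) s s1" "reg s1 h \<noteq> 0 \<longleftrightarrow> bval b \<sigma> \<mu>"
    using bexp_code_correct[OF rep loc \<open>0 < w\<close>, of P b] code fit by auto
  let ?s2 = "s1\<lparr>pc := if reg s1 h = 0 then l else pc s1 + 1\<rparr>"
  have "ram_step P w s1 ?s2"
    using s1(1) code by (simp add: ram_step_def scratch_run_def)
  show ?thesis
  proof (rule reachesI)
    show "(ram_step P w ^^ (bexp_cost b + 1)) s ?s2"
      using s1(1) \<open>ram_step P w s1 ?s2\<close> unfolding scratch_run_def Suc_eq_plus1[symmetric]
      by (blast intro: relpowp_Suc_I)
    show "pc ?s2 = (if bval b \<sigma> \<mu> then pc s + bexp_cost b + 1 else l)"
      using s1 by (auto simp: scratch_run_def)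
    show "represents w loc ?s2 \<sigma> \<mu>" using represents_scratch_run[OF rep s1(1) loc] by simp
  qed
qed

lemma assign_code_correct:
  assumes rep: "represents w loc s \<sigma> \<mu>" and loc: "\<And>x. loc x < h" and "inj loc"
    and code: "code_at P (pc s) (com_code loc h p (x ::= e))" and fit: "aexp_fits w e \<sigma> \<mu>"
  shows "reaches P w loc (aexp_cost e + 2) s (pc s + com_size (x ::= e)) (\<sigma>(x := aval e \<sigma> \<mu>)) \<mu>"
proof -
  obtain s1 where s1: "scratch_run P w h (aexp_cost e) s s1" "reg s1 h = aval e \<sigma> \<mu>"
    using aexp_code_correct[OF rep loc, of P e] code fit by auto
  let ?s2 = "set_reg (h + 1) 0 s1" and ?s3 = "set_reg (loc x) (aval e \<sigma> \<mu>) (set_reg (h + 1) 0 s1)"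
  have "scratch_run P w h (aexp_cost e + length [Const (h + 1) 0]) s
      (fold exec_instr [Const (h + 1) 0] s1)"
    using code s1(1)
    by (intro scratch_run_append[OF s1(1)]) (auto simp: scratch_run_def Let_def)
  hence s2: "scratch_run P w h (aexp_cost e + 1) s ?s2" by simp
  have bound: "aval e \<sigma> \<mu> < 2 ^ w" using s1 by (metis reg_less_two_power scratch_run_def)
  have step: "ram_step P w ?s2 ?s3"
    using code s1 bound by (simp add: ram_step_def scratch_run_def)
  show ?thesis
  proof (rule reachesI)
    have "(ram_step P w ^^ Suc (aexp_cost e + 1)) s ?s3"
      using s2 step unfolding scratch_run_def by (blast intro: relpowp_Suc_I)
    thus "(ram_step P w ^^ (aexp_cost e + 2)) s ?s3" by simp
    show "pc ?s3 = pc s + com_size (x ::= e)" using s1(1) by (simp add: scratch_run_def)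
    show "represents w loc ?s3 (\<sigma>(x := aval e \<sigma> \<mu>)) \<mu>"
      using represents_scratch_run[OF rep s2 loc] bound \<open>inj loc\<close>
      by (simp add: represents_def inj_eq)
  qed
qed

lemma write_code_correct:
  assumes rep: "represents w loc s \<sigma> \<mu>" and loc: "\<And>x. loc x < h"
    and code: "code_at P (pc s) (com_code loc h p (MEM[e] ::= f))"
    and fit: "aexp_fits w e \<sigma> \<mu>" "aexp_fits w f \<sigma> \<mu>"
  shows "reaches P w loc (aexp_cost e + aexp_cost f + 1) s (pc s + com_size (MEM[e] ::= f))
    \<sigma> (\<mu>(aval e \<sigma> \<mu> := aval f \<sigma> \<mu>))"
proof -
  obtain s1 where s1: "scratch_run P w h (aexp_cost e + aexp_cost f) s s1"
    "reg s1 h = aval e \<sigma> \<mu>" "reg s1 (h + 1) = aval f \<sigma> \<mu>"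
    using aexp_code_pair_correct[OF rep loc, of P e f] code fit by auto
  have rep1: "represents w loc s1 \<sigma> \<mu>" using represents_scratch_run[OF rep s1(1) loc] .
  let ?s2 = "exec_instr (Store h (h + 1)) s1"
  have step: "ram_step P w s1 ?s2"
    using code s1(1) by (simp add: ram_step_def scratch_run_def add.assoc fits_set_mem)
  hence fits: "fits w ?s2" unfolding ram_step_def by blast
  show ?thesis
  proof (rule reachesI)
    show "(ram_step P w ^^ (aexp_cost e + aexp_cost f + 1)) s ?s2"
      using s1(1) step unfolding scratch_run_def Suc_eq_plus1[symmetric]
      by (blast intro: relpowp_Suc_I)
    show "pc ?s2 = pc s + com_size (MEM[e] ::= f)" using s1(1) by (simp add: scratch_run_def)
    show "represents w loc ?s2 \<sigma> (\<mu>(aval e \<sigma> \<mu> := aval f \<sigma> \<mu>))"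
      using rep1 s1(2,3) fits by (auto simp: represents_def)
  qed
qed

lemma guarded_code_correct:
  assumes rep: "represents w loc s \<sigma> \<mu>" and loc: "\<And>x. loc x < h" and "0 < w"
    and b: "bexp_fits w b \<sigma> \<mu>" "bval b \<sigma> \<mu>"
    and c: "\<And>s. code_at P (pc s) (com_code loc h (pc s) c) \<Longrightarrow> represents w loc s \<sigma> \<mu> \<Longrightarrow>
      reaches P w loc t s (pc s + com_size c) \<sigma>' \<mu>'"
    and code: "code_at P (pc s)
      (bexp_code loc h b @ [JumpZ h l] @ com_code loc h (pc s + bexp_cost b + 1) c @ [Jump q])"
  shows "reaches P w loc (bexp_cost b + 1 + t + 1) s q \<sigma>' \<mu>'"
proof (rule reaches_trans[OF reaches_trans])
  let ?p = "pc s + bexp_cost b + 1"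
  show "reaches P w loc (bexp_cost b + 1) s ?p \<sigma> \<mu>"
    using branch_correct[OF rep loc \<open>0 < w\<close>, of P b l] code b by simp
  show "reaches P w loc t s1 (?p + com_size c) \<sigma>' \<mu>'"
    if "pc s1 = ?p" "represents w loc s1 \<sigma> \<mu>" for s1
    using c[OF _ that(2)] that(1) code by simp
  show "reaches P w loc 1 s2 q \<sigma>' \<mu>'"
    if "pc s2 = ?p + com_size c" "represents w loc s2 \<sigma>' \<mu>'" for s2
    using code that by (intro reaches_Jump) (simp_all add: add.assoc)
qed

theorem com_code_correct:
  assumes "big_step w c \<sigma> \<mu> t \<sigma>' \<mu>'" and w: "0 < w" and loc: "inj loc" "\<And>x. loc x < h"
    and "code_at P (pc s) (com_code loc h (pc s) c)" "represents w loc s \<sigma> \<mu>"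
  shows "reaches P w loc t s (pc s + com_size c) \<sigma>' \<mu>'"
  using assms(1,5,6)
proof (induction arbitrary: s rule: big_step.induct)
  case (Skip \<sigma> \<mu>)
  thus ?case by (auto simp: reaches_def)
next
  case (Assign e \<sigma> \<mu> x)
  show ?case using assign_code_correct[OF Assign.prems(2) loc(2,1) Assign.prems(1) Assign.hyps] .
next
  case (Write e \<sigma> \<mu> f)
  show ?case using write_code_correct[OF Write.prems(2) loc(2) Write.prems(1) Write.hyps] .
next
  case (Seq c \<sigma> \<mu> t \<sigma>' \<mu>' d u \<sigma>'' \<mu>'')
  have "reaches P w loc t s (pc s + com_size c) \<sigma>' \<mu>'"
    using Seq.IH(1) Seq.prems by simp
  moreover have "reaches P w loc u s1 (pc s + com_size (c ;; d)) \<sigma>'' \<mu>''"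
    if "pc s1 = pc s + com_size c" "represents w loc s1 \<sigma>' \<mu>'" for s1
    using Seq.IH(2)[of s1] Seq.prems(1) that by (simp add: add.assoc)
  ultimately show ?case by (rule reaches_trans)
next
  case (Cond_True b \<sigma> \<mu> c t \<sigma>' \<mu>' d)
  let ?r = "pc s + bexp_cost b + 1 + com_size c + 1"
  show ?case
    by (rule guarded_code_correct[OF Cond_True.prems(2) loc(2) w Cond_True.hyps(1,2) Cond_True.IH,
          where l = ?r])
      (use Cond_True.prems(1) in \<open>simp_all add: Let_def ac_simps\<close>)
next
  case (Cond_False b \<sigma> \<mu> d t \<sigma>' \<mu>' c)
  let ?q = "pc s + bexp_cost b + 1 + com_size c + 1"
  have "reaches P w loc (bexp_cost b + 1) s ?q \<sigma> \<mu>"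
    using branch_correct[OF Cond_False.prems(2) loc(2) w, of P b ?q] Cond_False.prems(1)
      Cond_False.hyps by (simp add: Let_def)
  moreover have "reaches P w loc t s1 (pc s + com_size (IF b THEN c ELSE d)) \<sigma>' \<mu>'"
    if "pc s1 = ?q" "represents w loc s1 \<sigma> \<mu>" for s1
    using Cond_False.IH[of s1] Cond_False.prems(1) that by (simp add: Let_def ac_simps)
  ultimately show ?case by (rule reaches_trans)
next
  case (While_False b \<sigma> \<mu> c)
  let ?q = "pc s + bexp_cost b + 1 + com_size c + 1"
  show ?case
    using branch_correct[OF While_False.prems(2) loc(2) w, of P b ?q] While_False.prems(1)
      While_False.hyps by (simp add: Let_def add.assoc)
next
  case (While_True b \<sigma> \<mu> c t \<sigma>' \<mu>' u \<sigma>'' \<mu>'')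
  let ?q = "pc s + bexp_cost b + 1 + com_size c + 1"
  have "reaches P w loc (bexp_cost b + 1 + t + 1) s (pc s) \<sigma>' \<mu>'"
    by (rule guarded_code_correct[OF While_True.prems(2) loc(2) w While_True.hyps(1,2)
          While_True.IH(1), where l = ?q])
      (use While_True.prems(1) in \<open>simp_all add: Let_def\<close>)
  moreover have "reaches P w loc u s1 (pc s + com_size (WHILE b DO c)) \<sigma>'' \<mu>''"
    if "pc s1 = pc s" "represents w loc s1 \<sigma>' \<mu>'" for s1
    using While_True.IH(2)[of s1] While_True.prems(1) that by simp
  ultimately show ?case by (rule reaches_trans)
qed

corollary wp_imp_ram_run:
  assumes "wp w c Q \<sigma> \<mu> k" and "0 < w" "inj loc" "\<And>x. loc x < h"
    and "represents w loc s \<sigma> \<mu>" "pc s = 0"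
  shows "\<exists>t s' \<sigma>'. t \<le> k \<and> ram_run (com_code loc h 0 c) w t s s' \<and>
    represents w loc s' \<sigma>' (mem s') \<and> Q \<sigma>' (mem s') (k - t)"
proof -
  obtain t \<sigma>' \<mu>' where run: "big_step w c \<sigma> \<mu> t \<sigma>' \<mu>'" and t: "t \<le> k" "Q \<sigma>' \<mu>' (k - t)"
    using assms(1) unfolding wp_def by blast
  have "code_at (com_code loc h 0 c) (pc s) (com_code loc h (pc s) c)"
    using assms(6) by (simp add: code_at_def)
  then obtain s' where s': "(ram_step (com_code loc h 0 c) w ^^ t) s s'" "pc s' = com_size c"
    "represents w loc s' \<sigma>' \<mu>'"
    using com_code_correct[OF run assms(2-4) _ assms(5)] assms(6) by (auto simp: reaches_def)
  hence "ram_run (com_code loc h 0 c) w t s s'"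
    using assms(5) by (simp add: ram_run_def halted_def represents_def)
  moreover have "\<mu>' = mem s'" using s'(3) by (simp add: represents_def)
  ultimately show ?thesis using t s'(3) by blast
qed


section \<open>Computing least periods\<close>

text \<open>
  \<open>Reg0\<close>, \<open>Reg1\<close> and \<open>Reg2\<close> are the input and output registers. The string of
  \<open>Height * Width = Size\<close> letters whose \<open>k\<close>-th letter is stored at
  \<open>strided_address Modulus Stride k\<close> spells out an array row by row: the input for
  \<open>Modulus = Size\<close> and \<open>Stride = 1\<close>, its transpose when they are the dimensions of the input.
\<close>

datatype var = Reg0 | Reg1 | Reg2 | Rows | Cols | Size | Modulus | Stride | Height | Width |
  Pos | Lo | Hi | Reach | Period | Root_Rows | Root_Cols

definition letter_exp :: "var aexp \<Rightarrow> var aexp" where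
  "letter_exp e = Read ((e MOD V Modulus) \<^bold>* V Stride \<^bold>+ e DIV V Modulus)"

definition extend_match :: "var com" where
  "extend_match =
     WHILE V Hi \<^bold>< V Size \<^bold>\<and> letter_exp (V Hi) \<^bold>= letter_exp (V Hi \<^bold>- V Pos) DO
       Hi ::= V Hi \<^bold>+ Lit 1"

definition extend_window :: "var com" where
  "extend_window =
     (IF V Hi \<^bold>< V Pos THEN Hi ::= V Pos ELSE SKIP) ;;
     extend_match ;;
     Reach ::= V Hi ;;
     Lo ::= V Pos"

definition reach_step :: "var com" where
  "reach_step =
     Reach ::= Read (V Size \<^bold>+ (V Pos \<^bold>- V Lo)) \<^bold>+ V Lo ;;
     (IF V Reach \<^bold>< V Hi THEN SKIP ELSE extend_window) ;;
     MEM[V Size \<^bold>+ V Pos] ::= V Reach ;;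
     Pos ::= V Pos \<^bold>+ Lit 1"

definition reach_table :: "var com" where
  "reach_table =
     MEM[V Size] ::= V Size ;;
     Pos ::= Lit 1 ;;
     Lo ::= Lit 1 ;;
     Hi ::= Lit 0 ;;
     WHILE \<^bold>\<not> (V Size \<^bold>< V Pos) DO reach_step"

definition period_search :: "var com" where
  "period_search =
     Period ::= Lit 1 ;;
     WHILE \<^bold>\<not> (V Height MOD V Period \<^bold>= Lit 0 \<^bold>\<and>
               Read (V Size \<^bold>+ V Period \<^bold>* V Width) \<^bold>= V Size) DO
       Period ::= V Period \<^bold>+ Lit 1"

definition find_least_period :: "var com" where
  "find_least_period = reach_table ;; period_search"

lemma assigned_extend_match [simp]: "assigned extend_match = {Hi}"
  by (simp add: extend_match_def)

lemma assigned_extend_window [simp]: "assigned extend_window = {Hi, Reach, Lo}"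
  by (auto simp: extend_window_def)

lemma assigned_reach_step [simp]: "assigned reach_step = {Hi, Reach, Lo, Pos}"
  by (auto simp: reach_step_def)

lemma assigned_find_least_period [simp]:
  "assigned find_least_period = {Hi, Reach, Lo, Pos, Period}"
  by (auto simp: find_least_period_def reach_table_def period_search_def)

locale string_view =
  fixes w m n P Q N :: nat and input :: memory
  assumes pos: "0 < m" "0 < n" and size: "N = m * n" "N = P * Q" and word: "2 * N < 2 ^ w"
begin

definition letter :: "nat \<Rightarrow> nat" where
  "letter k = input (strided_address P Q k)"

definition params :: "var store \<Rightarrow> bool" where
  "params \<sigma> \<longleftrightarrow> \<sigma> Size = N \<and> \<sigma> Modulus = P \<and> \<sigma> Stride = Q \<and> \<sigma> Height = m \<and> \<sigma> Width = n"

definition intact :: "memory \<Rightarrow> bool" where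
  "intact \<mu> \<longleftrightarrow> (\<forall>a<N. \<mu> a = input a)"

definition string_period :: "nat \<Rightarrow> bool" where
  "string_period d \<longleftrightarrow> 0 < d \<and> d dvd m \<and> has_period letter N (d * n)"

lemma N_pos: "0 < N"
  using pos size by simp

lemma aval_letter_exp:
  assumes "params \<sigma>" "intact \<mu>" "aval e \<sigma> \<mu> < N"
  shows "aval (letter_exp e) \<sigma> \<mu> = letter (aval e \<sigma> \<mu>)"
proof -
  have "strided_address P Q (aval e \<sigma> \<mu>) < N"
    using strided_address_less assms(3) unfolding size(2) .
  thus ?thesis using assms(1,2)
    by (simp add: letter_exp_def letter_def params_def intact_def flip: strided_address_def)
qed

lemma fits_letter_exp:
  assumes "params \<sigma>" "aexp_fits w e \<sigma> \<mu>" "aval e \<sigma> \<mu> \<le> N"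
  shows "aexp_fits w (letter_exp e) \<sigma> \<mu>"
proof -
  have "0 < P" using N_pos size by (auto intro: Nat.gr0I)
  hence "strided_address P Q (aval e \<sigma> \<mu>) < 2 ^ w"
    using strided_address_le[of "aval e \<sigma> \<mu>" P Q] assms(3) size word by linarith
  moreover from this have "(aval e \<sigma> \<mu> mod P) * Q < 2 ^ w" unfolding strided_address_def by linarith
  ultimately show ?thesis
    using assms(1,2) by (simp add: letter_exp_def params_def flip: strided_address_def)
qed

lemma aexp_cost_letter_exp: "aexp_cost (letter_exp e) = 2 * aexp_cost e + 13"
  by (simp add: letter_exp_def)

text \<open>
  Testing for one more matching letter takes 53 steps and advancing \<open>Hi\<close> another 7, so that the
  credits \<open>60 * (N - Hi)\<close> pay for all successful comparisons still to come.
\<close>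

lemma wp_extend_match:
  assumes par: "params \<sigma>" and mem: "intact \<mu>" and le: "\<sigma> Pos \<le> \<sigma> Hi" "\<sigma> Hi \<le> N"
    and match: "has_period letter (\<sigma> Hi) (\<sigma> Pos)"
    and credits: "60 * (N - \<sigma> Hi) + 53 + spare \<le> k"
  shows "wp w extend_match (\<lambda>\<sigma>' \<mu>' k'. \<mu>' = \<mu> \<and> \<sigma>' Hi = reach letter N (\<sigma> Pos) \<and>
    60 * (N - \<sigma>' Hi) + spare \<le> k') \<sigma> \<mu> k"
  unfolding extend_match_def
proof (rule wp_While[where I = "\<lambda>\<sigma>' \<mu>' k'. \<mu>' = \<mu> \<and> \<sigma> Pos \<le> \<sigma>' Hi \<and> \<sigma>' Hi \<le> N \<and>
    has_period letter (\<sigma>' Hi) (\<sigma> Pos) \<and> 60 * (N - \<sigma>' Hi) + 53 + spare \<le> k'"])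
  let ?more = "V Hi \<^bold>< V Size \<^bold>\<and> letter_exp (V Hi) \<^bold>= letter_exp (V Hi \<^bold>- V Pos)"
  fix \<sigma>' \<mu>' k'
  assume frame: "\<And>x. x \<notin> assigned (Hi ::= V Hi \<^bold>+ Lit 1) \<Longrightarrow> \<sigma>' x = \<sigma> x"
    and inv: "\<mu>' = \<mu> \<and> \<sigma> Pos \<le> \<sigma>' Hi \<and> \<sigma>' Hi \<le> N \<and>
      has_period letter (\<sigma>' Hi) (\<sigma> Pos) \<and> 60 * (N - \<sigma>' Hi) + 53 + spare \<le> k'"
  have par': "params \<sigma>'" using par frame by (simp add: params_def)
  have eqs: "\<mu>' = \<mu>" "\<sigma>' Pos = \<sigma> Pos" "\<sigma>' Size = N"
    using inv frame par by (simp_all add: params_def)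
  have cost: "bexp_cost ?more = 52" by (simp add: aexp_cost_letter_exp)
  show "bexp_fits w ?more \<sigma>' \<mu>' \<and> bexp_cost ?more + 1 \<le> k'"
    using inv eqs fits_letter_exp[OF par'] unfolding cost by auto
  have more: "bval ?more \<sigma>' \<mu>' \<longleftrightarrow> \<sigma>' Hi < N \<and> has_period letter (Suc (\<sigma>' Hi)) (\<sigma> Pos)"
    using inv eqs mem aval_letter_exp[OF par', of \<mu>] by (auto simp: has_period_Suc)
  show "wp w (Hi ::= V Hi \<^bold>+ Lit 1) (\<lambda>\<sigma>1 \<mu>1 k1. 1 \<le> k1 \<and> \<mu>1 = \<mu> \<and> \<sigma> Pos \<le> \<sigma>1 Hi \<and>
      \<sigma>1 Hi \<le> N \<and> has_period letter (\<sigma>1 Hi) (\<sigma> Pos) \<and>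
      60 * (N - \<sigma>1 Hi) + 53 + spare \<le> k1 - 1) \<sigma>' \<mu>' (k' - (bexp_cost ?more + 1))"
    if "bval ?more \<sigma>' \<mu>'"
    using that inv eqs word unfolding more cost by auto
  show "\<mu>' = \<mu> \<and> \<sigma>' Hi = reach letter N (\<sigma> Pos) \<and>
      60 * (N - \<sigma>' Hi) + spare \<le> k' - (bexp_cost ?more + 1)"
    if "\<not> bval ?more \<sigma>' \<mu>'"
    using that inv reach_eqI[of "\<sigma>' Hi" N letter "\<sigma> Pos"] unfolding more cost by auto
qed (use assms in auto)

lemma wp_extend_window:
  assumes par: "params \<sigma>" and mem: "intact \<mu>" and le: "\<sigma> Pos \<le> N" "\<sigma> Hi \<le> N"
    and match: "has_period letter (\<sigma> Hi) (\<sigma> Pos)"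
    and credits: "60 * (N - \<sigma> Hi) + 72 + spare \<le> k"
  shows "wp w extend_window (\<lambda>\<sigma>' \<mu>' k'. \<mu>' = \<mu> \<and> \<sigma>' Reach = reach letter N (\<sigma> Pos) \<and>
    \<sigma>' Lo = \<sigma> Pos \<and> \<sigma>' Hi \<le> N \<and> has_period letter (\<sigma>' Hi) (\<sigma>' Lo) \<and>
    60 * (N - \<sigma>' Hi) + spare \<le> k') \<sigma> \<mu> k" (is "wp w _ ?Q \<sigma> \<mu> k")
proof -
  have extend: "wp w extend_match (wp w (Reach ::= V Hi) (wp w (Lo ::= V Pos) ?Q)) \<sigma>' \<mu> k'"
    if \<sigma>': "\<sigma>' = \<sigma>(Hi := max (\<sigma> Pos) (\<sigma> Hi))" and k': "60 * (N - \<sigma>' Hi) + 61 + spare \<le> k'"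
    for \<sigma>' k'
  proof (rule wp_mono[OF wp_extend_match[of \<sigma>' \<mu> "spare + 8"]])
    show "params \<sigma>'" using par by (simp add: params_def \<sigma>')
    show "has_period letter (\<sigma>' Hi) (\<sigma>' Pos)"
      using match has_period_trivial[of "\<sigma> Pos" "\<sigma> Pos" letter] by (simp add: \<sigma>' max_def)
  next
    fix \<sigma>1 \<mu>1 k1
    assume frame: "\<And>x. x \<notin> assigned extend_match \<Longrightarrow> \<sigma>1 x = \<sigma>' x"
      and post: "\<mu>1 = \<mu> \<and> \<sigma>1 Hi = reach letter N (\<sigma>' Pos) \<and> 60 * (N - \<sigma>1 Hi) + (spare + 8) \<le> k1"
    have "\<sigma>1 Pos = \<sigma> Pos" by (simp add: frame \<sigma>')
    thus "wp w (Reach ::= V Hi) (wp w (Lo ::= V Pos) ?Q) \<sigma>1 \<mu>1 k1"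
      using post has_period_reach reach_le by (auto simp: \<sigma>')
  qed (use mem le k' in \<open>simp_all add: \<sigma>'\<close>)
  show ?thesis
    unfolding extend_window_def wp_Seq
    by (rule wp_CondI) (use credits in \<open>auto intro!: extend simp: max_def\<close>)
qed

text \<open>The window \<open>[Lo, Hi)\<close> is the match found so far that extends furthest to the right.\<close>

definition table_inv :: "var store \<Rightarrow> memory \<Rightarrow> bool" where
  "table_inv \<sigma> \<mu> \<longleftrightarrow> 1 \<le> \<sigma> Lo \<and> \<sigma> Lo \<le> \<sigma> Pos \<and> \<sigma> Pos \<le> N + 1 \<and> \<sigma> Hi \<le> N \<and>
     has_period letter (\<sigma> Hi) (\<sigma> Lo) \<and> intact \<mu> \<and>
     (\<forall>j<\<sigma> Pos. \<mu> (N + j) = reach letter N j)"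

lemma intact_update: "intact \<mu> \<Longrightarrow> intact (\<mu>(N + j := v))"
  by (simp add: intact_def)

lemma wp_reach_update:
  assumes par: "params \<sigma>" and inv: "table_inv \<sigma> \<mu>" and le: "\<sigma> Pos \<le> N"
    and copy: "\<sigma> Reach = reach letter N (\<sigma> Pos - \<sigma> Lo) + \<sigma> Lo"
    and credits: "60 * (N - \<sigma> Hi) + 79 + spare \<le> k"
  shows "wp w (IF V Reach \<^bold>< V Hi THEN SKIP ELSE extend_window) (\<lambda>\<sigma>' \<mu>' k'. \<mu>' = \<mu> \<and>
    table_inv \<sigma>' \<mu> \<and> \<sigma>' Reach = reach letter N (\<sigma> Pos) \<and> 60 * (N - \<sigma>' Hi) + spare \<le> k') \<sigma> \<mu> k"
    (is "wp w _ ?Q \<sigma> \<mu> k")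
proof (rule wp_CondI)
  have Lo: "\<sigma> Lo \<le> \<sigma> Pos" and Hi: "\<sigma> Hi \<le> N" "has_period letter (\<sigma> Hi) (\<sigma> Lo)" and mem: "intact \<mu>"
    using inv by (simp_all add: table_inv_def)
  show "wp w SKIP (\<lambda>\<sigma> \<mu> k. 1 \<le> k \<and> ?Q \<sigma> \<mu> (k - 1)) \<sigma> \<mu> (k - (bexp_cost (V Reach \<^bold>< V Hi) + 1))"
    if "bval (V Reach \<^bold>< V Hi) \<sigma> \<mu>"
    using that reach_add[OF Hi(2,1), of "\<sigma> Pos - \<sigma> Lo"] Lo copy inv credits by auto
  show "wp w extend_window ?Q \<sigma> \<mu> (k - (bexp_cost (V Reach \<^bold>< V Hi) + 1))"
    if "\<not> bval (V Reach \<^bold>< V Hi) \<sigma> \<mu>"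
  proof (rule wp_mono[OF wp_extend_window[OF par mem le Hi(1), of spare]])
    show "has_period letter (\<sigma> Hi) (\<sigma> Pos)"
      using that has_period_add_reach[OF Hi(2), of N "\<sigma> Pos - \<sigma> Lo"] Lo copy by simp
  next
    fix \<sigma>' \<mu>' k'
    assume frame: "\<And>x. x \<notin> assigned extend_window \<Longrightarrow> \<sigma>' x = \<sigma> x"
      and post: "\<mu>' = \<mu> \<and> \<sigma>' Reach = reach letter N (\<sigma> Pos) \<and> \<sigma>' Lo = \<sigma> Pos \<and> \<sigma>' Hi \<le> N \<and>
        has_period letter (\<sigma>' Hi) (\<sigma>' Lo) \<and> 60 * (N - \<sigma>' Hi) + spare \<le> k'"
    have "\<sigma>' Pos = \<sigma> Pos" by (simp add: frame)
    thus "?Q \<sigma>' \<mu>' k'" using post inv by (auto simp: table_inv_def)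
  qed (use credits in simp)
qed (use credits in simp_all)

lemma wp_reach_step:
  assumes par: "params \<sigma>" and inv: "table_inv \<sigma> \<mu>" and le: "\<sigma> Pos \<le> N"
    and credits: "60 * (N - \<sigma> Hi) + 107 + spare \<le> k"
  shows "wp w reach_step (\<lambda>\<sigma>' \<mu>' k'. table_inv \<sigma>' \<mu>' \<and> \<sigma>' Pos = \<sigma> Pos + 1 \<and>
    60 * (N - \<sigma>' Hi) + spare \<le> k') \<sigma> \<mu> k" (is "wp w _ ?Q \<sigma> \<mu> k")
proof -
  let ?copy = "reach letter N (\<sigma> Pos - \<sigma> Lo) + \<sigma> Lo"
  let ?rest = "wp w (MEM[V Size \<^bold>+ V Pos] ::= V Reach) (wp w (Pos ::= V Pos \<^bold>+ Lit 1) ?Q)"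
  have Size: "\<sigma> Size = N" using par by (simp add: params_def)
  have Lo: "1 \<le> \<sigma> Lo" "\<sigma> Lo \<le> \<sigma> Pos" and table: "\<And>j. j < \<sigma> Pos \<Longrightarrow> \<mu> (N + j) = reach letter N j"
    using inv by (simp_all add: table_inv_def)
  have copy: "aval (Read (V Size \<^bold>+ (V Pos \<^bold>- V Lo)) \<^bold>+ V Lo) \<sigma> \<mu> = ?copy"
    using table[of "\<sigma> Pos - \<sigma> Lo"] Lo by (simp add: Size)
  have fits: "N + (\<sigma> Pos - \<sigma> Lo) < 2 ^ w" "?copy < 2 ^ w"
    using reach_le[of letter N "\<sigma> Pos - \<sigma> Lo"] Lo le word by linarith+
  have "wp w (IF V Reach \<^bold>< V Hi THEN SKIP ELSE extend_window) ?rest (\<sigma>(Reach := ?copy)) \<mu> (k - 14)"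
  proof (rule wp_mono[OF wp_reach_update[of _ _ "spare + 14"]])
    fix \<sigma>' \<mu>' k'
    assume frame: "\<And>x. x \<notin> assigned (IF V Reach \<^bold>< V Hi THEN SKIP ELSE extend_window) \<Longrightarrow>
        \<sigma>' x = (\<sigma>(Reach := ?copy)) x"
      and post: "\<mu>' = \<mu> \<and> table_inv \<sigma>' \<mu> \<and> \<sigma>' Reach = reach letter N ((\<sigma>(Reach := ?copy)) Pos) \<and>
        60 * (N - \<sigma>' Hi) + (spare + 14) \<le> k'"
    have eqs: "\<sigma>' Size = N" "\<sigma>' Pos = \<sigma> Pos" by (simp_all add: frame Size)
    hence "table_inv (\<sigma>'(Pos := \<sigma> Pos + 1)) (\<mu>(N + \<sigma> Pos := \<sigma>' Reach))"
      using post le by (auto simp: table_inv_def less_Suc_eq intact_update)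
    thus "?rest \<sigma>' \<mu>' k'" using post eqs le word N_pos by auto
  qed (use par inv le credits in \<open>auto simp: params_def table_inv_def\<close>)
  thus ?thesis
    unfolding reach_step_def wp_Seq wp_Assign[of w Reach] copy
    using fits credits Size copy by auto
qed

lemma wp_reach_table:
  assumes par: "params \<sigma>" and mem: "intact \<mu>" and credits: "180 * N + 25 + spare \<le> k"
  shows "wp w reach_table (\<lambda>\<sigma>' \<mu>' k'. intact \<mu>' \<and> (\<forall>j\<le>N. \<mu>' (N + j) = reach letter N j) \<and>
    spare \<le> k') \<sigma> \<mu> k" (is "wp w _ ?Q \<sigma> \<mu> k")
proof -
  let ?\<sigma> = "\<sigma>(Pos := 1, Lo := 1, Hi := 0)" and ?\<mu> = "\<mu>(N := N)"
  let ?I = "\<lambda>\<sigma>' \<mu>' k'. table_inv \<sigma>' \<mu>' \<and> 60 * (N - \<sigma>' Hi) + 117 * (N + 1 - \<sigma>' Pos) + 8 + spare \<le> k'"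
  let ?b = "\<^bold>\<not> (V Size \<^bold>< V Pos)"
  have "wp w (WHILE ?b DO reach_step) ?Q ?\<sigma> ?\<mu> (k - 14)"
  proof (rule wp_While[where I = ?I])
    fix \<sigma>' \<mu>' k' assume frame: "\<And>x. x \<notin> assigned reach_step \<Longrightarrow> \<sigma>' x = ?\<sigma> x" and inv: "?I \<sigma>' \<mu>' k'"
    have par': "params \<sigma>'" and Size: "\<sigma>' Size = N" using par by (simp_all add: params_def frame)
    show "bexp_fits w ?b \<sigma>' \<mu>' \<and> bexp_cost ?b + 1 \<le> k'" using inv by simp
    show "wp w reach_step (\<lambda>\<sigma> \<mu> k. 1 \<le> k \<and> ?I \<sigma> \<mu> (k - 1)) \<sigma>' \<mu>' (k' - (bexp_cost ?b + 1))"
      if "bval ?b \<sigma>' \<mu>'"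
    proof (rule wp_mono[OF wp_reach_step[OF par', of _ "117 * (N - \<sigma>' Pos) + 9 + spare"]])
      show "\<sigma>' Pos \<le> N" using that Size by simp
      thus "60 * (N - \<sigma>' Hi) + 107 + (117 * (N - \<sigma>' Pos) + 9 + spare) \<le> k' - (bexp_cost ?b + 1)"
        using inv by (auto simp: Suc_diff_le)
    qed (use inv in auto)
    show "?Q \<sigma>' \<mu>' (k' - (bexp_cost ?b + 1))" if "\<not> bval ?b \<sigma>' \<mu>'"
      using that inv Size by (auto simp: table_inv_def)
  next
    have "reach letter N 0 = N" by (simp add: reach_eq_iff has_period_def)
    thus "?I ?\<sigma> ?\<mu> (k - 14)"
      using mem intact_update[OF mem, of 0] credits has_period_trivial[of 0 1 letter]
      by (auto simp: table_inv_def)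
  qed
  moreover have "\<sigma> Size = N" using par by (simp add: params_def)
  ultimately show ?thesis unfolding reach_table_def using credits word N_pos by auto
qed

lemma string_period_dim: "string_period m"
  unfolding string_period_def using pos size(1) by (simp add: has_period_trivial)

lemma wp_period_search:
  assumes par: "params \<sigma>" and mem: "intact \<mu>"
    and table: "\<And>j. j \<le> N \<Longrightarrow> \<mu> (N + j) = reach letter N j"
    and credits: "41 * m + 3 + spare \<le> k"
  shows "wp w period_search (\<lambda>\<sigma>' \<mu>' k'. intact \<mu>' \<and>
    \<sigma>' Period = (LEAST d. string_period d) \<and> spare \<le> k') \<sigma> \<mu> k"
    (is "wp w _ ?Q \<sigma> \<mu> k")
proof -
  let ?b = "\<^bold>\<not> (V Height MOD V Period \<^bold>= Lit 0 \<^bold>\<and>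
    Read (V Size \<^bold>+ V Period \<^bold>* V Width) \<^bold>= V Size)"
  let ?body = "Period ::= V Period \<^bold>+ Lit 1"
  let ?I = "\<lambda>\<sigma>' \<mu>' k'. \<mu>' = \<mu> \<and> 1 \<le> \<sigma>' Period \<and> \<sigma>' Period \<le> m \<and> (\<forall>d<\<sigma>' Period. \<not> string_period d) \<and>
    41 * (m - \<sigma>' Period) + 34 + spare \<le> k'"
  have "wp w (WHILE ?b DO ?body) ?Q (\<sigma>(Period := 1)) \<mu> (k - 3)"
  proof (rule wp_While[where I = ?I])
    fix \<sigma>' \<mu>' k'
    assume frame: "\<And>x. x \<notin> assigned ?body \<Longrightarrow> \<sigma>' x = (\<sigma>(Period := 1)) x" and inv: "?I \<sigma>' \<mu>' k'"
    have eqs: "\<sigma>' Size = N" "\<sigma>' Height = m" "\<sigma>' Width = n"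
      using par by (simp_all add: params_def frame)
    have le: "\<sigma>' Period * n \<le> N" "m \<le> N" using inv pos unfolding size(1) by simp_all
    have test: "bval ?b \<sigma>' \<mu>' \<longleftrightarrow> \<not> string_period (\<sigma>' Period)"
      using inv le(1) by (auto simp: eqs string_period_def table reach_eq_iff)
    show "bexp_fits w ?b \<sigma>' \<mu>' \<and> bexp_cost ?b + 1 \<le> k'" using inv le word by (auto simp: eqs)
    show "wp w ?body (\<lambda>\<sigma> \<mu> k. 1 \<le> k \<and> ?I \<sigma> \<mu> (k - 1)) \<sigma>' \<mu>' (k' - (bexp_cost ?b + 1))"
      if "bval ?b \<sigma>' \<mu>'"
    proof -
      have "\<sigma>' Period < m"
        using that inv string_period_dim unfolding test by (cases "\<sigma>' Period = m") auto
      thus ?thesis using that inv le word unfolding test by (auto simp: less_Suc_eq)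
    qed
    show "?Q \<sigma>' \<mu>' (k' - (bexp_cost ?b + 1))" if "\<not> bval ?b \<sigma>' \<mu>'"
    proof -
      have "(LEAST d. string_period d) = \<sigma>' Period"
        using that inv unfolding test by (intro Least_equality) (auto simp: not_less[symmetric])
      thus ?thesis using inv mem by (auto simp: string_period_def)
    qed
  qed (use credits pos in \<open>auto simp: string_period_def\<close>)
  thus ?thesis unfolding period_search_def using credits word N_pos
    by (auto simp: numeral_3_eq_3)
qed

lemma wp_find_least_period:
  assumes "params \<sigma>" "intact \<mu>" "221 * N + 28 + spare \<le> k"
  shows "wp w find_least_period (\<lambda>\<sigma>' \<mu>' k'. intact \<mu>' \<and>
    \<sigma>' Period = (LEAST d. string_period d) \<and> spare \<le> k') \<sigma> \<mu> k"
  unfolding find_least_period_def wp_Seq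
proof (rule wp_mono[OF wp_reach_table[OF assms(1,2), of "41 * m + 3 + spare"]])
  have "m \<le> N" using pos unfolding size(1) by simp
  thus "180 * N + 25 + (41 * m + 3 + spare) \<le> k" using assms(3) by linarith
next
  fix \<sigma>' \<mu>' k'
  assume "\<And>x. x \<notin> assigned reach_table \<Longrightarrow> \<sigma>' x = \<sigma> x"
    and "intact \<mu>' \<and> (\<forall>j\<le>N. \<mu>' (N + j) = reach letter N j) \<and> 41 * m + 3 + spare \<le> k'"
  moreover from this(1) have "params \<sigma>'" using assms(1) by (simp add: params_def reach_table_def)
  ultimately show "wp w period_search (\<lambda>\<sigma>' \<mu>' k'. intact \<mu>' \<and>
      \<sigma>' Period = (LEAST d. string_period d) \<and> spare \<le> k') \<sigma>' \<mu>' k'"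
    by (intro wp_period_search) simp_all
qed

end


section \<open>The program\<close>

definition find_row_period :: "var com" where
  "find_row_period =
     Modulus ::= V Size ;; Stride ::= Lit 1 ;; Height ::= V Rows ;; Width ::= V Cols ;;
     find_least_period ;;
     Root_Rows ::= V Period"

definition find_col_period :: "var com" where
  "find_col_period =
     Modulus ::= V Rows ;; Stride ::= V Cols ;; Height ::= V Cols ;; Width ::= V Rows ;;
     find_least_period ;;
     Root_Cols ::= V Period"

definition copy_corner :: "var com" where
  "copy_corner =
     Pos ::= Lit 0 ;;
     WHILE V Pos \<^bold>< V Root_Rows \<^bold>* V Root_Cols DO
       (MEM[V Pos] ::= Read (V Pos DIV V Root_Cols \<^bold>* V Cols \<^bold>+ V Pos MOD V Root_Cols) ;;
        Pos ::= V Pos \<^bold>+ Lit 1)"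

definition write_output :: "var com" where
  "write_output =
     (IF V Root_Rows \<^bold>* V Root_Cols \<^bold>= V Size THEN Reg0 ::= Lit 1 ELSE Reg0 ::= Lit 0) ;;
     Reg1 ::= V Root_Rows ;;
     Reg2 ::= V Root_Cols"

definition root_program :: "var com" where
  "root_program =
     Rows ::= V Reg0 ;; Cols ::= V Reg1 ;; Size ::= V Rows \<^bold>* V Cols ;;
     find_row_period ;;
     find_col_period ;;
     copy_corner ;;
     write_output"

lemma assigned_copy_corner [simp]: "assigned copy_corner = {Pos}"
  by (simp add: copy_corner_def)

text \<open>The copy is in place; it is sound because no entry moves to a higher address.\<close>

lemma wp_copy_corner:
  assumes \<sigma>: "\<sigma> Cols = n" "\<sigma> Root_Rows = r" "\<sigma> Root_Cols = c"
    and rc: "r \<le> m" "0 < c" "c \<le> n" and word: "m * n < 2 ^ w"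
    and credits: "36 * (r * c) + 12 + spare \<le> k"
  shows "wp w copy_corner (\<lambda>\<sigma>' \<mu>' k'.
    (\<forall>b<r * c. \<mu>' b = \<mu> (corner_address c n b)) \<and> spare \<le> k') \<sigma> \<mu> k"
    (is "wp w _ ?Q \<sigma> \<mu> k")
proof -
  let ?b = "V Pos \<^bold>< V Root_Rows \<^bold>* V Root_Cols"
  let ?body = "MEM[V Pos] ::= Read (V Pos DIV V Root_Cols \<^bold>* V Cols \<^bold>+ V Pos MOD V Root_Cols) ;;
    Pos ::= V Pos \<^bold>+ Lit 1"
  let ?I = "\<lambda>\<sigma>' \<mu>' k'. \<sigma>' Pos \<le> r * c \<and> (\<forall>b\<ge>\<sigma>' Pos. \<mu>' b = \<mu> b) \<and>
    (\<forall>b<\<sigma>' Pos. \<mu>' b = \<mu> (corner_address c n b)) \<and> 36 * (r * c - \<sigma>' Pos) + 9 + spare \<le> k'"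
  have N: "r * c \<le> m * n" using rc by (intro mult_le_mono) auto
  have "wp w (WHILE ?b DO ?body) ?Q (\<sigma>(Pos := 0)) \<mu> (k - 3)"
  proof (rule wp_While[where I = ?I])
    fix \<sigma>' \<mu>' k'
    assume frame: "\<And>x. x \<notin> assigned ?body \<Longrightarrow> \<sigma>' x = (\<sigma>(Pos := 0)) x" and inv: "?I \<sigma>' \<mu>' k'"
    have eqs: "\<sigma>' Cols = n" "\<sigma>' Root_Rows = r" "\<sigma>' Root_Cols = c" using \<sigma> by (simp_all add: frame)
    show "bexp_fits w ?b \<sigma>' \<mu>' \<and> bexp_cost ?b + 1 \<le> k'" using inv N word by (auto simp: eqs)
    show "wp w ?body (\<lambda>\<sigma> \<mu> k. 1 \<le> k \<and> ?I \<sigma> \<mu> (k - 1)) \<sigma>' \<mu>' (k' - (bexp_cost ?b + 1))"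
      if "bval ?b \<sigma>' \<mu>'"
    proof -
      have less: "\<sigma>' Pos < r * c" using that by (simp add: eqs)
      have "corner_address c n (\<sigma>' Pos) < 2 ^ w"
        using corner_address_less[OF less rc] word by linarith
      moreover from this have "\<sigma>' Pos div c * n < 2 ^ w" unfolding corner_address_def by linarith
      moreover have "\<mu>' (corner_address c n (\<sigma>' Pos)) = \<mu> (corner_address c n (\<sigma>' Pos))"
        using inv corner_address_ge[OF rc(3)] by blast
      ultimately show ?thesis
        using inv less N word by (auto simp: eqs less_Suc_eq simp flip: corner_address_def)
    qed
    show "?Q \<sigma>' \<mu>' (k' - (bexp_cost ?b + 1))" if "\<not> bval ?b \<sigma>' \<mu>'"
      using that inv by (auto simp: eqs)
  qed (use credits in auto)
  thus ?thesis unfolding copy_corner_def using credits by (auto simp: numeral_3_eq_3)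
qed

lemma wp_write_output:
  assumes "\<sigma> Root_Rows = r" "\<sigma> Root_Cols = c" "\<sigma> Size = N" "0 < w" "r * c < 2 ^ w" "30 \<le> k"
  shows "wp w write_output (\<lambda>\<sigma>' \<mu>' _. \<mu>' = \<mu> \<and> \<sigma>' Reg0 = (if r * c = N then 1 else 0) \<and>
    \<sigma>' Reg1 = r \<and> \<sigma>' Reg2 = c) \<sigma> \<mu> k"
proof -
  have "1 < (2 :: nat) ^ w" using assms(4) by (rule one_less_power[rotated]) simp
  thus ?thesis unfolding write_output_def wp_Seq by (intro wp_CondI) (use assms in auto)
qed

lemma mult_eq_mult_iff_eq:
  assumes "a \<le> m" "b \<le> n" "0 < m" "0 < (n :: nat)"
  shows "a * b = m * n \<longleftrightarrow> a = m \<and> b = n"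
proof
  assume eq: "a * b = m * n"
  have "m * n \<le> a * n" "m * n \<le> m * b" using assms(1,2) by (simp_all flip: eq)
  thus "a = m \<and> b = n" using assms by simp
qed simp

locale array_input =
  fixes w m n N :: nat and code :: "'a \<Rightarrow> nat" and A :: "'a mat" and input :: memory
  assumes dim: "A \<in> carrier_mat m n" "0 < m" "0 < n" and size: "N = m * n"
    and inj: "inj_on code (elements_mat A)"
    and word: "2 * N < 2 ^ w" and input: "\<And>k. k < N \<Longrightarrow> input k = code (row_major A k)"
begin

sublocale rows: string_view w m n N 1 N input
  using dim size word by unfold_locales simp_all

sublocale cols: string_view w n m m n N input
  using dim size word by unfold_locales simp_all

lemma nonempty: "nonempty_array A"
  using dim by (simp add: nonempty_array_def)

lemma least_row_period_eq_string_period: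
  "least_row_period A = (LEAST d. rows.string_period d)"
proof -
  have "rows.letter k = code (row_major A k)" if "k < dim_row A * dim_col A" for k
    unfolding rows.letter_def using that dim size by (simp add: strided_address_def input)
  from least_row_period_eq_Least[OF inj this] show ?thesis
    unfolding rows.string_period_def using dim size by simp
qed

lemma least_col_period_eq_string_period:
  "least_col_period A = (LEAST d. cols.string_period d)"
proof -
  have "inj_on code (elements_mat (transpose_mat A))"
    using inj by (rule inj_on_subset) (auto simp: elements_mat_def)
  moreover have "cols.letter k = code (row_major (transpose_mat A) k)"
    if "k < dim_row (transpose_mat A) * dim_col (transpose_mat A)" for k
  proof -
    have k: "k < m * n" using that dim by (simp add: mult.commute)
    hence "cols.letter k = code (row_major A (strided_address m n k))"
      unfolding cols.letter_def using strided_address_less size by (simp add: input)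
    thus ?thesis using row_major_transpose[of k A] k dim by simp
  qed
  ultimately show ?thesis
    unfolding cols.string_period_def
    using least_row_period_eq_Least[of code "transpose_mat A" cols.letter] dim size
    by (simp add: mult.commute)
qed

lemma wp_find_row_period:
  assumes \<sigma>: "\<sigma> Rows = m" "\<sigma> Cols = n" "\<sigma> Size = N" and mem: "rows.intact \<mu>"
    and credits: "221 * N + 50 + spare \<le> k"
  shows "wp w find_row_period (\<lambda>\<sigma>' \<mu>' k'. rows.intact \<mu>' \<and> \<sigma>' Root_Rows = least_row_period A \<and>
    spare \<le> k') \<sigma> \<mu> k" (is "wp w _ ?Q \<sigma> \<mu> k")
proof -
  let ?\<sigma> = "\<sigma>(Modulus := N, Stride := 1, Height := m, Width := n)"
  have "rows.params ?\<sigma>" unfolding rows.params_def using \<sigma> by simp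
  hence "wp w find_least_period (wp w (Root_Rows ::= V Period) ?Q) ?\<sigma> \<mu> (k - 15)"
    by (rule wp_mono[OF rows.wp_find_least_period[OF _ mem, of _ "spare + 4"]])
      (use credits in \<open>auto simp: least_row_period_eq_string_period\<close>)
  thus ?thesis unfolding find_row_period_def wp_Seq using \<sigma> credits word rows.N_pos by auto
qed

lemma wp_find_col_period:
  assumes \<sigma>: "\<sigma> Rows = m" "\<sigma> Cols = n" "\<sigma> Size = N" and mem: "cols.intact \<mu>"
    and credits: "221 * N + 50 + spare \<le> k"
  shows "wp w find_col_period (\<lambda>\<sigma>' \<mu>' k'. cols.intact \<mu>' \<and> \<sigma>' Root_Cols = least_col_period A \<and>
    spare \<le> k') \<sigma> \<mu> k" (is "wp w _ ?Q \<sigma> \<mu> k")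
proof -
  let ?\<sigma> = "\<sigma>(Modulus := m, Stride := n, Height := n, Width := m)"
  have "cols.params ?\<sigma>" unfolding cols.params_def using \<sigma> by simp
  hence "wp w find_least_period (wp w (Root_Cols ::= V Period) ?Q) ?\<sigma> \<mu> (k - 16)"
    by (rule wp_mono[OF cols.wp_find_least_period[OF _ mem, of _ "spare + 4"]])
      (use credits in \<open>auto simp: least_col_period_eq_string_period\<close>)
  thus ?thesis unfolding find_col_period_def wp_Seq using \<sigma> credits by auto
qed

definition root_computed :: "var store \<Rightarrow> memory \<Rightarrow> bool" where
  "root_computed \<sigma> \<mu> \<longleftrightarrow> \<sigma> Reg0 = (if primitive_array A then 1 else 0) \<and>
     \<sigma> Reg1 = dim_row (corner A) \<and> \<sigma> Reg2 = dim_col (corner A) \<and>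
     (\<forall>b < dim_row (corner A) * dim_col (corner A). \<mu> b = code (row_major (corner A) b))"

lemma wp_copy_and_output:
  assumes \<sigma>: "\<sigma> Cols = n" "\<sigma> Size = N" "\<sigma> Root_Rows = least_row_period A"
      "\<sigma> Root_Cols = least_col_period A"
    and mem: "rows.intact \<mu>" and credits: "36 * N + 42 \<le> k"
  shows "wp w (copy_corner ;; write_output) (\<lambda>\<sigma>' \<mu>' _. root_computed \<sigma>' \<mu>') \<sigma> \<mu> k"
    (is "wp w _ ?Q \<sigma> \<mu> k")
  unfolding wp_Seq
proof -
  define r c where "r = least_row_period A" and "c = least_col_period A"
  note \<sigma> = \<sigma>[folded r_def c_def]
  have rc: "r \<le> m" "0 < c" "c \<le> n"
    using least_row_period(4)[OF nonempty] least_col_period(2,4)[OF nonempty] dim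
    by (simp_all add: r_def c_def)
  hence rcN: "r * c \<le> N" unfolding size by (intro mult_le_mono)
  have corner: "\<mu> (corner_address c n b) = code (row_major (corner A) b)" if "b < r * c" for b
    using corner_address_less[OF that rc] row_major_corner[OF nonempty, of b] that dim
      mem[unfolded rows.intact_def, unfolded size]
    by (simp add: input size r_def c_def)
  have primitive: "r * c = N \<longleftrightarrow> primitive_array A"
    using mult_eq_mult_iff_eq[OF rc(1,3) dim(2,3)] dim
      primitive_array_iff_least_periods[OF nonempty]
    by (simp add: size r_def c_def)
  show "wp w copy_corner (wp w write_output ?Q) \<sigma> \<mu> k"
  proof (rule wp_mono[OF wp_copy_corner[OF \<sigma>(1,3,4) rc, of w 30]])
    fix \<sigma>' \<mu>' and k' :: nat
    assume frame: "\<And>x. x \<notin> assigned copy_corner \<Longrightarrow> \<sigma>' x = \<sigma> x"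
      and post: "(\<forall>b<r * c. \<mu>' b = \<mu> (corner_address c n b)) \<and> 30 \<le> k'"
    have "\<sigma>' Root_Rows = r" "\<sigma>' Root_Cols = c" "\<sigma>' Size = N" using \<sigma> by (simp_all add: frame)
    moreover have "0 < w" "r * c < 2 ^ w" using word rcN rows.N_pos by (auto intro: Nat.gr0I)
    ultimately show "wp w write_output ?Q \<sigma>' \<mu>' k'"
      using post corner primitive
      by (intro wp_mono[OF wp_write_output[of _ r c N]])
        (simp_all add: root_computed_def flip: r_def c_def)
  qed (use rcN credits word size in auto)
qed

lemma wp_root_program:
  assumes \<sigma>: "\<sigma> Reg0 = m" "\<sigma> Reg1 = n" and credits: "700 * N \<le> k"
  shows "wp w root_program (\<lambda>\<sigma>' \<mu>' _. root_computed \<sigma>' \<mu>') \<sigma> input k"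
    (is "wp w _ ?Q \<sigma> input k")
proof -
  have col: "wp w find_col_period (wp w (copy_corner ;; write_output) ?Q) \<sigma>' \<mu>' k'"
    if \<sigma>': "\<sigma>' Rows = m" "\<sigma>' Cols = n" "\<sigma>' Size = N" "\<sigma>' Root_Rows = least_row_period A"
      and mem: "rows.intact \<mu>'" and k': "257 * N + 92 \<le> k'" for \<sigma>' \<mu>' k'
    by (rule wp_mono[OF wp_find_col_period[OF \<sigma>'(1-3) mem, of "36 * N + 42"]])
      (use \<sigma>' k' in \<open>auto intro!: wp_copy_and_output simp: find_col_period_def simp del: wp_Seq\<close>)
  have intact: "rows.intact input" by (simp add: rows.intact_def)
  have row: "wp w find_row_period
      (wp w find_col_period (wp w (copy_corner ;; write_output) ?Q)) \<sigma>' input k'"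
    if \<sigma>': "\<sigma>' Rows = m" "\<sigma>' Cols = n" "\<sigma>' Size = N" and k': "478 * N + 142 \<le> k'" for \<sigma>' k'
    by (rule wp_mono[OF wp_find_row_period[OF \<sigma>' intact, of "257 * N + 92"]])
      (use \<sigma>' k' in \<open>auto intro!: col simp: find_row_period_def simp del: wp_Seq\<close>)
  have "478 * N + 157 \<le> k" using credits rows.N_pos by linarith
  thus ?thesis
    unfolding root_program_def wp_Seq[of w "_ ::= _"] wp_Seq[of w find_row_period]
      wp_Seq[of w find_col_period]
    using \<sigma> word by (auto intro!: row simp: size simp del: wp_Seq)
qed

end

fun loc :: "var \<Rightarrow> nat" where
  "loc Reg0 = 0"
| "loc Reg1 = 1"
| "loc Reg2 = 2"
| "loc Rows = 3"
| "loc Cols = 4"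
| "loc Size = 5"
| "loc Modulus = 6"
| "loc Stride = 7"
| "loc Height = 8"
| "loc Width = 9"
| "loc Pos = 10"
| "loc Lo = 11"
| "loc Hi = 12"
| "loc Reach = 13"
| "loc Period = 14"
| "loc Root_Rows = 15"
| "loc Root_Cols = 16"

lemma loc_less: "loc x < 17"
  by (cases x) simp_all

lemma inj_loc: "inj loc"
proof (rule injI)
  fix x y assume "loc x = loc y"
  thus "x = y" by (cases x; cases y; simp)
qed

definition input_store :: "'a mat \<Rightarrow> var store" where
  "input_store A = (\<lambda>_. 0)(Reg0 := dim_row A, Reg1 := dim_col A)"

lemma represents_input_config:
  assumes "A \<in> carrier_mat m n" "m < 2 ^ w" "n < 2 ^ w" "\<And>a. a \<in> elements_mat A \<Longrightarrow> code a < 2 ^ w"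
  shows "represents w loc (input_config code A) (input_store A) (mem (input_config code A))"
  unfolding represents_def
proof (intro conjI allI)
  have "code (row_major A a) < 2 ^ w" if "a < dim_row A * dim_col A" for a
    using assms(4) row_major_in_elements_mat[OF that] .
  thus "fits w (input_config code A)"
    using assms(1-3) by (auto simp: fits_def input_config_def row_major_def)
  show "reg (input_config code A) (loc x) = input_store A x" for x
    by (cases x) (simp_all add: input_config_def input_store_def)
qed simp

lemma stores_arrayI:
  assumes "\<And>b. b < dim_row C * dim_col C \<Longrightarrow> mem s b = code (row_major C b)"
  shows "stores_array code s C"
  unfolding stores_array_def using assms row_major_index_less row_major_index by metis

lemma power_le_two_power_if_log_le:
  assumes "real w \<ge> real k * log 2 (real N + 1)"
  shows "(N + 1) ^ k \<le> 2 ^ w"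
proof -
  have "(real N + 1) ^ k = (real N + 1) powr real k" by (rule powr_realpow[symmetric]) simp
  also have "\<dots> = 2 powr (real k * log 2 (real N + 1))"
    by (subst mult.commute) (simp add: powr_powr[symmetric])
  also have "\<dots> \<le> 2 powr real w" using assms by (intro powr_mono) auto
  finally have "real ((N + 1) ^ k) \<le> real (2 ^ w)" by (simp add: powr_realpow add.commute)
  thus ?thesis by (simp only: of_nat_le_iff)
qed

lemma word_size_sufficient:
  assumes "real w \<ge> real (K + 2) * log 2 (real N + 1)" "0 < N"
  shows "2 * N < 2 ^ w" "2 ^ K \<le> (2 :: nat) ^ w"
proof -
  have "2 ^ (K + 1) * (N + 1) \<le> (N + 1) ^ (K + 1) * (N + 1)"
    using assms(2) by (intro mult_le_mono1 power_mono) simp_all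
  also have "\<dots> = (N + 1) ^ (K + 2)" by (simp add: mult.commute)
  also have "\<dots> \<le> 2 ^ w" using assms(1) by (rule power_le_two_power_if_log_le)
  finally have bound: "2 ^ K * (2 * N + 2) \<le> 2 ^ w" by (simp add: algebra_simps)
  have "1 * (2 * N + 2) \<le> 2 ^ w" by (rule order.trans[OF mult_le_mono1 bound]) simp
  thus "2 * N < 2 ^ w" by simp
  have "2 ^ K * 1 \<le> (2 :: nat) ^ w" by (rule order.trans[OF mult_le_mono2 bound]) simp
  thus "2 ^ K \<le> (2 :: nat) ^ w" by simp
qed

lemma root_program_correct:
  assumes A: "A \<in> carrier_mat m n" "0 < m" "0 < n" and inj: "inj_on code (elements_mat A)"
    and bound: "2 * (m * n) < 2 ^ w" "\<And>a. a \<in> elements_mat A \<Longrightarrow> code a < 2 ^ w"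
  shows "\<exists>t s. t \<le> 700 * (m * n) \<and>
    ram_run (com_code loc 17 0 root_program) w t (input_config code A) s \<and> output_correct code A s"
proof -
  interpret array_input w m n "m * n" code A "mem (input_config code A)"
    using A inj bound(1) by unfold_locales (auto simp: input_config_def row_major_def)
  have "0 < w" using bound(1) A(2,3) by (auto intro: Nat.gr0I)
  have "m \<le> m * n" "n \<le> m * n" using A(2,3) by simp_all
  hence "m < 2 ^ w" "n < 2 ^ w" using bound(1) by linarith+
  note rep = represents_input_config[OF A(1) this bound(2)]
  have "pc (input_config code A) = 0" by (simp add: input_config_def)
  from wp_imp_ram_run[OF wp_root_program[OF _ _ order_refl] \<open>0 < w\<close> inj_loc loc_less rep this]
  obtain t s \<sigma> where t: "t \<le> 700 * (m * n)"
      "ram_run (com_code loc 17 0 root_program) w t (input_config code A) s"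
    and rep: "represents w loc s \<sigma> (mem s)" and root: "root_computed \<sigma> (mem s)"
    using A(1) by (auto simp: input_store_def)
  have "reg s 0 = \<sigma> Reg0" "reg s 1 = \<sigma> Reg1" "reg s 2 = \<sigma> Reg2"
    using rep unfolding represents_def by (metis loc.simps(1-3))+
  moreover have "stores_array code s (corner A)"
    using root by (intro stores_arrayI) (simp add: root_computed_def)
  ultimately have "output_correct code A s"
    using root primitive_root_eq_corner[OF nonempty]
    by (simp add: output_correct_def root_computed_def)
  with t show ?thesis by blast
qed

theorem theorem15:
  fixes \<Sigma> :: "'a set" and code :: "'a \<Rightarrow> nat"
  assumes "finite \<Sigma>" and "inj_on code \<Sigma>"
  shows "\<exists>(P :: instr list) (c :: nat) (k :: nat).
           \<forall>(m :: nat) (n :: nat) (A :: 'a mat) (w :: nat).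
             m > 0 \<longrightarrow> n > 0 \<longrightarrow> A \<in> carrier_mat m n \<longrightarrow> elements_mat A \<subseteq> \<Sigma> \<longrightarrow>
             real w \<ge> real k * log 2 (real (m * n) + 1) \<longrightarrow>
             (\<exists>t s. t \<le> c * (m * n) \<and> ram_run P w t (input_config code A) s \<and>
                    output_correct code A s)"
proof -
  define P where "P = com_code loc 17 0 root_program"
  define K where "K = sum code \<Sigma>"
  have code_less: "code a < 2 ^ K" if "a \<in> \<Sigma>" for a
  proof -
    have "code a \<le> K" unfolding K_def using assms(1) that by (intro member_le_sum) simp_all
    thus ?thesis using less_exp[of K] by linarith
  qed
  have "\<exists>t s. t \<le> 700 * (m * n) \<and> ram_run P w t (input_config code A) s \<and> output_correct code A s"
    if mn: "m > 0" "n > 0" and A: "A \<in> carrier_mat m n" and letters: "elements_mat A \<subseteq> \<Sigma>"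
      and w: "real w \<ge> real (K + 2) * log 2 (real (m * n) + 1)" for m n A w
  proof -
    have bound: "2 * (m * n) < 2 ^ w" "(2 :: nat) ^ K \<le> 2 ^ w"
      using word_size_sufficient[OF w] mn by simp_all
    have "code a < 2 ^ w" if "a \<in> elements_mat A" for a
      using code_less letters bound(2) that by (meson less_le_trans subsetD)
    with root_program_correct[OF A mn inj_on_subset[OF assms(2) letters] bound(1)]
    show ?thesis unfolding P_def .
  qed
  thus ?thesis by blast
qed

end
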